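(* Let $M$ be a $2m$-dimensional manifold in the image of the generalized supergravity r-map described by a homogeneous function $h$ of degree $D\in\mathbb{R}^{>0}\setminus\{1\}$. Then the Ricci tensor and the scalar curvature are given by $$Ric_{\mu\bar\nu}=-\partial_{z^\mu}\partial_{\bar z^\nu}\log\frac{d}{h^m},$$ $$scal=-m^2+\frac{D-2}{D-1}m-\frac{h}{d}d^\mu_{\ \mu}+\frac{h}{d^2}d^\mu d_\mu,$$ where $d(x):=\det(\partial^2h(x))$.
   Context: Generalized supergravity r-map. Let $U\subset\mathbb{R}^{n+1}$ be a domain invariant under multiplication by positive numbers and $h:U\to\mathbb{R}^{>0}$ a smooth function homogeneous of degree $D\in\mathbb{R}^{>0}\setminus\{1\}$. Assume that $-\partial^2h$ induces (by restriction to $T\mathcal{H}\times T\mathcal{H}$) a Riemannian metric on the smooth hypersurface $\mathcal{H}:=\{x\in U\mid h(x)=1\}$. Put $m:=n+1$ and $M:=\mathbb{R}^{n+1}+iU\subset\mathbb{C}^{n+1}$ with standard holomorphic coordinates $z^\mu=y^\mu+ix^\mu$, $x\in U$, $y\in\mathbb{R}^{n+1}$. Endow $M$ with the Kähler metric $g_M=2g_{\mu\bar\nu}dz^\mu d\bar z^\nu$, $g_{\mu\bar\nu}:=\frac{\partial^2K}{\partial z^\mu\partial\bar z^\nu}$, $K(z,\bar z)=-\log h(x)$. The correspondence $\mathcal{H}\mapsto(M,g_M)$ is the generalized supergravity r-map. Notation. The functions $h$, $d$ and their derivatives are evaluated at $x=\mathrm{Im}\,z$. $h_{\mu\nu}=\partial^2h/\partial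 x^\mu\partial x^\nu$, $d_\mu=\partial d/\partial x^\mu$, $d_{\mu\nu}=\partial^2d/\partial x^\mu\partial x^\nu$; $(h^{\mu\nu})$ is the inverse of the matrix $(h_{\mu\nu})$. Indices are raised with the metric $-\partial^2h$, i.e. by contraction with $-h^{\mu\nu}$, so $d^\mu_{\ \mu}=-h^{\mu\nu}d_{\mu\nu}$ and $d^\mu d_\mu=-h^{\mu\nu}d_\mu d_\nu$; repeated indices are summed. The function $d$ has no zeros on $U$; if $d<0$, the logarithm is understood up to an additive constant, i.e. as $\log(|d|/h^m)$. Curvature conventions. With $R(X,Y)Z=\nabla_X\nabla_YZ-\nabla_Y\nabla_XZ-\nabla_{[X,Y]}Z$ for the Levi-Civita connection, $R^\rho_{\ \sigma\mu\bar\nu}:=dz^\rho\big(R(\partial_{z^\mu},\partial_{\bar z^\nu})\partial_{z^\sigma}\big)$, $Ric_{\mu\bar\nu}:=R^\rho_{\ \mu\rho\bar\nu}$, and $scal:=g^{\mu\bar\nu}Ric_{\mu\bar\nu}$ with $(g^{\bar\nu\lambda})$ the inverse matrix of $(g_{\mu\bar\nu})$; thus $scal$ is one half of the usual Riemannian scalar curvature. *)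

theory Defs
  imports "HOL-Analysis.Analysis"
begin

section \<open>Calculus on open subsets\<close>

text \<open>\<open>C\<^sup>k\<close> and smooth maps; the definitions are meant for open \<open>S\<close>.\<close>

primrec Ck_on :: "nat \<Rightarrow> ('a::real_normed_vector \<Rightarrow> 'b::real_normed_vector) \<Rightarrow> 'a set \<Rightarrow> bool" where
  "Ck_on 0 f S \<longleftrightarrow> continuous_on S f"
| "Ck_on (Suc k) f S \<longleftrightarrow>
     (\<forall>x\<in>S. f differentiable (at x)) \<and> (\<forall>v. Ck_on k (\<lambda>x. frechet_derivative f (at x) v) S)"

definition smooth_on :: "('a::real_normed_vector \<Rightarrow> 'b::real_normed_vector) \<Rightarrow> 'a set \<Rightarrow> bool" where
  "smooth_on f S \<longleftrightarrow> (\<forall>k. Ck_on k f S)"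

definition pd :: "'n \<Rightarrow> (real^'n \<Rightarrow> real) \<Rightarrow> real^'n \<Rightarrow> real" where
  "pd i f x = frechet_derivative f (at x) (axis i 1)"

definition hessian :: "(real^'n \<Rightarrow> real) \<Rightarrow> real^'n \<Rightarrow> real^'n^'n" where
  "hessian f x = (\<chi> i j. pd i (pd j f) x)"


section \<open>Levi-Civita connection and curvature\<close>

text \<open>A metric on an open subset of a real normed space \<open>'a\<close> is a function
  \<open>g :: 'a \<Rightarrow> 'a \<Rightarrow> 'a \<Rightarrow> real\<close>, the first argument being the base point. Tangent spaces are
  identified with \<open>'a\<close>, and every connection has the form \<open>\<nabla>\<^sub>X Y = D\<^sub>X Y + \<Gamma>(X, Y)\<close> with \<open>D\<close>
  the flat derivative and \<open>\<Gamma>\<close> bilinear at each point. Such a connection is torsion-free iff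
  \<open>\<Gamma>\<close> is symmetric, and metric iff \<open>X(g(Y,Z)) = g(\<nabla>\<^sub>X Y, Z) + g(Y, \<nabla>\<^sub>X Z)\<close> holds for
  constant fields. The Levi-Civita connection is the unique one with both properties.\<close>

definition levi_civita_at ::
    "('a::real_normed_vector \<Rightarrow> 'a \<Rightarrow> 'a \<Rightarrow> real) \<Rightarrow> 'a \<Rightarrow> ('a \<Rightarrow> 'a \<Rightarrow> 'a) \<Rightarrow> bool" where
  "levi_civita_at g z \<Gamma> \<longleftrightarrow>
     bilinear \<Gamma> \<and>
     (\<forall>u v. \<Gamma> u v = \<Gamma> v u) \<and>
     (\<forall>u v w. frechet_derivative (\<lambda>p. g p v w) (at z) u = g z (\<Gamma> u v) w + g z v (\<Gamma> u w))"

definition christoffel ::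
    "('a::real_normed_vector \<Rightarrow> 'a \<Rightarrow> 'a \<Rightarrow> real) \<Rightarrow> 'a \<Rightarrow> 'a \<Rightarrow> 'a \<Rightarrow> 'a" where
  "christoffel g z = (THE \<Gamma>. levi_civita_at g z \<Gamma>)"

definition nabla ::
    "('a::real_normed_vector \<Rightarrow> 'a \<Rightarrow> 'a \<Rightarrow> real) \<Rightarrow> ('a \<Rightarrow> 'a) \<Rightarrow> ('a \<Rightarrow> 'a) \<Rightarrow> 'a \<Rightarrow> 'a" where
  "nabla g X Y z = frechet_derivative Y (at z) (X z) + christoffel g z (X z) (Y z)"

definition lie_bracket :: "('a::real_normed_vector \<Rightarrow> 'a) \<Rightarrow> ('a \<Rightarrow> 'a) \<Rightarrow> 'a \<Rightarrow> 'a" where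
  "lie_bracket X Y z = frechet_derivative Y (at z) (X z) - frechet_derivative X (at z) (Y z)"

definition curvature ::
    "('a::real_normed_vector \<Rightarrow> 'a \<Rightarrow> 'a \<Rightarrow> real) \<Rightarrow>
     ('a \<Rightarrow> 'a) \<Rightarrow> ('a \<Rightarrow> 'a) \<Rightarrow> ('a \<Rightarrow> 'a) \<Rightarrow> 'a \<Rightarrow> 'a" where
  "curvature g X Y Z z =
     nabla g X (nabla g Y Z) z - nabla g Y (nabla g X Z) z - nabla g (lie_bracket X Y) Z z"


section \<open>Complexified tangent vectors\<close>

text \<open>A pair \<open>(a, b)\<close> stands for the element \<open>a + \<i> b\<close> of the complexification of the real
  vector space \<open>'a\<close>; \<open>cext \<phi>\<close> is the complex-linear extension of the real-linear map \<open>\<phi>\<close>.\<close>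

definition cext :: "('a \<Rightarrow> complex) \<Rightarrow> 'a \<times> 'a \<Rightarrow> complex" where
  "cext \<phi> w = \<phi> (fst w) + \<i> * \<phi> (snd w)"

text \<open>With \<open>z = y + \<i> x\<close>, the coordinate fields of \<open>y\<^sup>\<mu>\<close> and \<open>x\<^sup>\<mu>\<close> are the constant fields
  \<open>axis \<mu> 1\<close> and \<open>axis \<mu> \<i>\<close>; the two definitions are \<open>(\<partial>/\<partial>y \<mp> \<i> \<partial>/\<partial>x) / 2\<close>.\<close>

definition del_z :: "'n \<Rightarrow> (complex^'n) \<times> (complex^'n)" where
  "del_z \<mu> = ((1/2) *\<^sub>R axis \<mu> 1, - (1/2) *\<^sub>R axis \<mu> \<i>)"

definition del_zbar :: "'n \<Rightarrow> (complex^'n) \<times> (complex^'n)" where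
  "del_zbar \<mu> = ((1/2) *\<^sub>R axis \<mu> 1, (1/2) *\<^sub>R axis \<mu> \<i>)"

definition pdz :: "'n \<Rightarrow> (complex^'n \<Rightarrow> complex) \<Rightarrow> complex^'n \<Rightarrow> complex" where
  "pdz \<mu> f z = cext (frechet_derivative f (at z)) (del_z \<mu>)"

definition pdzbar :: "'n \<Rightarrow> (complex^'n \<Rightarrow> complex) \<Rightarrow> complex^'n \<Rightarrow> complex" where
  "pdzbar \<mu> f z = cext (frechet_derivative f (at z)) (del_zbar \<mu>)"

text \<open>\<open>R\<^sup>\<rho>\<^sub>\<sigma>\<^sub>\<mu>\<^sub>\<nu>\<close> with \<open>\<nu>\<close> barred: the \<open>dz\<^sup>\<rho>\<close>-component (\<open>v $ \<rho>\<close> on real tangent vectors)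
  of \<open>R(\<partial>\<^sub>\<mu>, \<partial>\<^sub>\<nu>)\<partial>\<^sub>\<sigma>\<close>, extended complex-multilinearly. The vector fields involved are constant.\<close>

definition curv_coeff ::
    "(complex^'n \<Rightarrow> complex^'n \<Rightarrow> complex^'n \<Rightarrow> real) \<Rightarrow> 'n \<Rightarrow> 'n \<Rightarrow> 'n \<Rightarrow> 'n \<Rightarrow> complex^'n \<Rightarrow> complex"
  where
  "curv_coeff g \<rho> \<sigma> \<mu> \<nu> z =
     cext (\<lambda>u. cext (\<lambda>v. cext (\<lambda>w. curvature g (\<lambda>_. u) (\<lambda>_. v) (\<lambda>_. w) z $ \<rho>)
       (del_z \<sigma>)) (del_zbar \<nu>)) (del_z \<mu>)"

definition Ricci :: "(complex^'n \<Rightarrow> complex^'n \<Rightarrow> complex^'n \<Rightarrow> real) \<Rightarrow> complex^'n \<Rightarrow> complex^'n^'n" where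
  "Ricci g z = (\<chi> \<mu> \<nu>. \<Sum>\<rho>\<in>UNIV. curv_coeff g \<rho> \<mu> \<rho> \<nu> z)"


section \<open>The generalized supergravity r-map\<close>

definition Im_vec :: "complex^'n \<Rightarrow> real^'n" where
  "Im_vec z = (\<chi> i. Im (z $ i))"

definition tube :: "(real^'n) set \<Rightarrow> (complex^'n) set" where
  "tube U = {z. Im_vec z \<in> U}"

definition kpot :: "(real^'n \<Rightarrow> real) \<Rightarrow> complex^'n \<Rightarrow> complex" where
  "kpot h z = complex_of_real (- ln (h (Im_vec z)))"

definition gmat :: "(real^'n \<Rightarrow> real) \<Rightarrow> complex^'n \<Rightarrow> complex^'n^'n" where
  "gmat h z = (\<chi> \<mu> \<nu>. pdz \<mu> (pdzbar \<nu> (kpot h)) z)"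

text \<open>The tensor \<open>2 g\<^sub>\<mu>\<^sub>\<nu> dz\<^sup>\<mu> d\<zeta>\<^sup>\<nu>\<close>, where \<open>\<zeta>\<close> is the conjugate coordinate and juxtaposition is
  the symmetric product \<open>\<alpha>\<beta> = (\<alpha> \<otimes> \<beta> + \<beta> \<otimes> \<alpha>) / 2\<close>. The sum is real since \<open>gmat h z\<close> is
  Hermitian; \<open>Re\<close> only adjusts the type.\<close>

definition gM :: "(real^'n \<Rightarrow> real) \<Rightarrow> complex^'n \<Rightarrow> complex^'n \<Rightarrow> complex^'n \<Rightarrow> real" where
  "gM h z v w =
     Re (\<Sum>\<mu>\<in>UNIV. \<Sum>\<nu>\<in>UNIV. gmat h z $ \<mu> $ \<nu> * (v $ \<mu> * cnj (w $ \<nu>) + w $ \<mu> * cnj (v $ \<nu>)))"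

definition Ric :: "(real^'n \<Rightarrow> real) \<Rightarrow> complex^'n \<Rightarrow> complex^'n^'n" where
  "Ric h z = Ricci (gM h) z"

text \<open>In \<open>matrix_inv (gmat h z) $ \<nu> $ \<mu>\<close> the first index is the barred one. This is one half of
  the Riemannian scalar curvature.\<close>

definition scal :: "(real^'n \<Rightarrow> real) \<Rightarrow> complex^'n \<Rightarrow> complex" where
  "scal h z = (\<Sum>\<mu>\<in>UNIV. \<Sum>\<nu>\<in>UNIV. matrix_inv (gmat h z) $ \<nu> $ \<mu> * Ric h z $ \<mu> $ \<nu>)"

definition hdet :: "(real^'n \<Rightarrow> real) \<Rightarrow> real^'n \<Rightarrow> real" where
  "hdet h x = det (hessian h x)"

text \<open>Contractions with \<open>- h\<^sup>\<mu>\<^sup>\<nu>\<close>, the inverse of \<open>-\<partial>\<^sup>2h\<close>: \<open>f\<^sup>\<mu>\<^sub>\<mu>\<close> and \<open>f\<^sup>\<mu> f\<^sub>\<mu>\<close>.\<close>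

definition up_trace :: "(real^'n \<Rightarrow> real) \<Rightarrow> (real^'n \<Rightarrow> real) \<Rightarrow> real^'n \<Rightarrow> real" where
  "up_trace h f x = (\<Sum>\<mu>\<in>UNIV. \<Sum>\<nu>\<in>UNIV. - matrix_inv (hessian h x) $ \<mu> $ \<nu> * pd \<mu> (pd \<nu> f) x)"

definition up_square :: "(real^'n \<Rightarrow> real) \<Rightarrow> (real^'n \<Rightarrow> real) \<Rightarrow> real^'n \<Rightarrow> real" where
  "up_square h f x = (\<Sum>\<mu>\<in>UNIV. \<Sum>\<nu>\<in>UNIV. - matrix_inv (hessian h x) $ \<mu> $ \<nu> * pd \<mu> f x * pd \<nu> f x)"

text \<open>\<open>-\<partial>\<^sup>2h\<close> restricts to a Riemannian metric on \<open>{h = 1}\<close>, whose tangent space at \<open>x\<close> is the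
  kernel of \<open>dh\<close>. For homogeneous \<open>h\<close> of nonzero degree the level set is regular by Euler's
  identity; symmetry and smoothness of the form are automatic for smooth \<open>h\<close>.\<close>

definition riemannian_level_set :: "(real^'n) set \<Rightarrow> (real^'n \<Rightarrow> real) \<Rightarrow> bool" where
  "riemannian_level_set U h \<longleftrightarrow>
     (\<forall>x\<in>U. h x = 1 \<longrightarrow>
       (\<forall>v. frechet_derivative h (at x) v = 0 \<and> v \<noteq> 0 \<longrightarrow> - (v \<bullet> (hessian h x *v v)) > 0))"

end

theory Submission
  imports Defs
begin

text \<open>All tensors depend on \<open>x = Im z\<close> only; write \<open>\<partial>\<^sub>\<mu> = \<partial>/\<partial>x\<^sup>\<mu>\<close>. With \<open>G = (g\<^sub>\<mu>\<^sub>\<nu>)\<close>, a quarter of the Hessian of \<open>- log h\<close>, and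
  \<open>C\<^sup>\<rho>\<^sub>\<mu>\<^sub>\<sigma> = (G\<^sup>-\<^sup>1)\<^sup>\<rho>\<^sup>\<lambda> \<partial>\<^sub>\<mu>G\<^sub>\<lambda>\<^sub>\<sigma> / 2\<close>, the total symmetry of \<open>\<partial>G\<close> makes the complex-bilinear form
  \<open>- \<i> C\<close> the Levi-Civita connection, so the only curvature component that matters comes from
  differentiating \<open>C\<close> in an antiholomorphic direction: \<open>Ric\<^sub>\<mu>\<^sub>\<nu> = - \<partial>\<^sub>\<nu> C\<^sup>\<rho>\<^sub>\<rho>\<^sub>\<mu> / 2\<close>. Euler's identities give
  \<open>G\<^sup>-\<^sup>1 = 4 (- h H\<^sup>-\<^sup>1 + x x\<^sup>T / (D - 1))\<close> for \<open>H = \<partial>\<^sup>2h\<close>. Together with Jacobi's formula for the derivative of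
  \<open>d = det H\<close> they turn the trace \<open>2 C\<^sup>\<rho>\<^sub>\<rho>\<^sub>\<mu>\<close> into \<open>\<partial>\<^sub>\<mu> log (d / h\<^sup>m)\<close>. The scalar curvature follows by contracting
  with \<open>G\<^sup>-\<^sup>1\<close>, since \<open>d\<close> is homogeneous of degree \<open>m (D - 2)\<close>.\<close>

section \<open>Partial derivatives\<close>

lemma smooth_on_differentiable: "smooth_on f S \<Longrightarrow> x \<in> S \<Longrightarrow> f differentiable (at x)"
  unfolding smooth_on_def using Ck_on.simps(2) by blast

lemma smooth_on_frechet_derivative:
  "smooth_on f S \<Longrightarrow> smooth_on (\<lambda>x. frechet_derivative f (at x) v) S"
  unfolding smooth_on_def using Ck_on.simps(2) by blast

lemma smooth_on_pd: "smooth_on f S \<Longrightarrow> smooth_on (pd i f) S"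
  using smooth_on_frechet_derivative[of f S "axis i 1"] unfolding pd_def[abs_def] .

lemma pd_eqI: "(f has_derivative f') (at x) \<Longrightarrow> pd i f x = f' (axis i 1)"
  unfolding pd_def using frechet_derivative_at by metis

lemma has_derivative_pd:
  fixes f :: "real^'n \<Rightarrow> real"
  assumes "f differentiable (at x)"
  shows "(f has_derivative (\<lambda>v. \<Sum>i\<in>UNIV. v $ i * pd i f x)) (at x)"
proof -
  let ?F = "frechet_derivative f (at x)"
  have F: "(f has_derivative ?F) (at x)"
    using assms frechet_derivative_works by blast
  have lin: "linear ?F"
    using F has_derivative_linear by blast
  have "?F v = (\<Sum>i\<in>UNIV. v $ i * pd i f x)" for v
  proof -
    have "?F v = ?F (\<Sum>i\<in>UNIV. (v $ i) *\<^sub>R axis i 1)"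
      using basis_expansion[of v] by (simp add: scalar_mult_eq_scaleR)
    also have "\<dots> = (\<Sum>i\<in>UNIV. v $ i * pd i f x)"
      by (simp add: linear_sum[OF lin] linear_scale[OF lin] pd_def)
    finally show ?thesis .
  qed
  then show ?thesis using F by presburger
qed

lemma has_derivative_pd_compose:
  fixes f :: "real^'n \<Rightarrow> real"
  assumes "f differentiable (at (c t))" "(c has_derivative c') (at t within S)"
  shows "((\<lambda>s. f (c s)) has_derivative (\<lambda>v. \<Sum>i\<in>UNIV. c' v $ i * pd i f (c t))) (at t within S)"
  using has_derivative_compose[OF assms(2) has_derivative_pd[OF assms(1)]] .

section \<open>Symmetry of mixed second partial derivatives\<close>

lemma pd_has_real_derivative:
  fixes f :: "real^'n \<Rightarrow> real"
  assumes "f differentiable (at (p + t *\<^sub>R axis i 1))"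
  shows "((\<lambda>s. f (p + s *\<^sub>R axis i 1)) has_real_derivative pd i f (p + t *\<^sub>R axis i 1)) (at t)"
proof -
  have "((\<lambda>s. p + s *\<^sub>R axis i 1) has_derivative (\<lambda>s. s *\<^sub>R axis i (1::real))) (at t)"
    by (auto intro!: derivative_eq_intros)
  from has_derivative_pd_compose[OF assms this]
  have "((\<lambda>s. f (p + s *\<^sub>R axis i 1)) has_derivative
      (\<lambda>v. \<Sum>k\<in>UNIV. (v *\<^sub>R axis i 1) $ k * pd k f (p + t *\<^sub>R axis i 1))) (at t)" .
  moreover have "(\<Sum>k\<in>UNIV. (v *\<^sub>R axis i 1) $ k * pd k f (p + t *\<^sub>R axis i 1))
      = pd i f (p + t *\<^sub>R axis i 1) * v" for v
    by (simp add: axis_def if_distrib[of "\<lambda>z. _ * z"] if_distrib[of "\<lambda>z. z * _"] cong: if_cong)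
  ultimately show ?thesis
    by (simp add: has_field_derivative_def)
qed

text \<open>Differentiating the second difference first in direction \<open>i\<close> and then in direction \<open>j\<close>
  gives one mixed partial derivative; it is symmetric in \<open>i\<close> and \<open>j\<close>.\<close>

lemma second_difference_mean_value:
  fixes f :: "real^'n \<Rightarrow> real"
  assumes sm: "smooth_on f S" and sub: "ball x r \<subseteq> S" and s: "0 < s" "2 * s < r"
  shows "\<exists>p\<in>ball x r. f (x + s *\<^sub>R axis i 1 + s *\<^sub>R axis j 1) - f (x + s *\<^sub>R axis i 1)
     - f (x + s *\<^sub>R axis j 1) + f x = s\<^sup>2 * pd j (pd i f) p"
proof -
  have inball: "x + a *\<^sub>R axis i 1 + b *\<^sub>R axis j 1 \<in> ball x r" if "0 \<le> a" "a \<le> s" "0 \<le> b" "b \<le> s" for a b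
  proof -
    have "norm (a *\<^sub>R axis i 1 + b *\<^sub>R axis j (1::real)) \<le> \<bar>a\<bar> + \<bar>b\<bar>"
      using norm_triangle_ineq[of "a *\<^sub>R axis i 1" "b *\<^sub>R axis j (1::real)"] by simp
    then have "norm (a *\<^sub>R axis i 1 + b *\<^sub>R axis j (1::real)) < r" using that s by linarith
    moreover have "dist x (x + a *\<^sub>R axis i 1 + b *\<^sub>R axis j 1) = norm (a *\<^sub>R axis i 1 + b *\<^sub>R axis j (1::real))"
      by (metis add.assoc add_diff_cancel_left' dist_commute dist_norm)
    ultimately show ?thesis by simp
  qed
  have dif: "g differentiable (at (x + a *\<^sub>R axis i 1 + b *\<^sub>R axis j 1))"
    if "smooth_on g S" "0 \<le> a" "a \<le> s" "0 \<le> b" "b \<le> s" for a b and g :: "real^'n \<Rightarrow> real"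
    using smooth_on_differentiable[OF that(1)] inball[OF that(2-5)] sub by blast
  define \<phi> where "\<phi> a = f (x + s *\<^sub>R axis j 1 + a *\<^sub>R axis i 1) - f (x + a *\<^sub>R axis i 1)" for a
  have d\<phi>: "DERIV \<phi> a :> pd i f (x + s *\<^sub>R axis j 1 + a *\<^sub>R axis i 1) - pd i f (x + a *\<^sub>R axis i 1)"
    if "0 \<le> a" "a \<le> s" for a
    unfolding \<phi>_def
    using dif[OF sm that, of s] dif[OF sm that, of 0] s
    by (intro DERIV_diff pd_has_real_derivative) (simp_all add: add.commute add.left_commute)
  obtain a where a: "0 < a" "a < s" and
    1: "\<phi> s - \<phi> 0 = (s - 0) * (pd i f (x + s *\<^sub>R axis j 1 + a *\<^sub>R axis i 1) - pd i f (x + a *\<^sub>R axis i 1))"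
    using MVT2[OF s(1) d\<phi>] by blast
  have "DERIV (\<lambda>b. pd i f (x + a *\<^sub>R axis i 1 + b *\<^sub>R axis j 1)) b
        :> pd j (pd i f) (x + a *\<^sub>R axis i 1 + b *\<^sub>R axis j 1)" if "0 \<le> b" "b \<le> s" for b
    using dif[OF smooth_on_pd[OF sm], of a b] a that
    by (intro pd_has_real_derivative) (simp_all add: add.assoc)
  from MVT2[OF s(1) this] obtain b where b: "0 < b" "b < s" and
    2: "pd i f (x + a *\<^sub>R axis i 1 + s *\<^sub>R axis j 1) - pd i f (x + a *\<^sub>R axis i 1 + 0 *\<^sub>R axis j 1)
       = (s - 0) * pd j (pd i f) (x + a *\<^sub>R axis i 1 + b *\<^sub>R axis j 1)"
    by blast
  have "\<phi> s - \<phi> 0 = s\<^sup>2 * pd j (pd i f) (x + a *\<^sub>R axis i 1 + b *\<^sub>R axis j 1)"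
    using 1 2 by (simp add: power2_eq_square algebra_simps)
  moreover have "x + a *\<^sub>R axis i 1 + b *\<^sub>R axis j 1 \<in> ball x r"
    using inball a b by simp
  ultimately show ?thesis
    unfolding \<phi>_def by (intro bexI[rotated]) (assumption, simp add: algebra_simps)
qed

text \<open>The second difference is the same for both orders of \<open>i\<close> and
  \<open>j\<close>, so by \<open>second_difference_mean_value\<close> the two mixed partials share a
  value, taken at points \<open>p\<close> and \<open>q\<close> near \<open>x\<close>. If they
  differed at \<open>x\<close>, continuity would keep them apart on a small ball.\<close>

lemma pd_commute:
  fixes f :: "real^'n \<Rightarrow> real"
  assumes sm: "smooth_on f S" and "open S" "x \<in> S"
  shows "pd i (pd j f) x = pd j (pd i f) x"
proof (rule ccontr)
  assume ne: "pd i (pd j f) x \<noteq> pd j (pd i f) x"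
  \<comment> \<open>Half the gap: a common value cannot be closer than \<open>e\<close> to both
    mixed partials at \<open>x\<close>.\<close>
  define e where "e = \<bar>pd i (pd j f) x - pd j (pd i f) x\<bar> / 2"
  have e: "e > 0" using ne by (simp add: e_def)
  have cont: "isCont (pd k (pd l f)) x" for k l
    using smooth_on_differentiable[OF smooth_on_pd[OF smooth_on_pd[OF sm]] \<open>x \<in> S\<close>]
      differentiable_imp_continuous_within by blast
  obtain r1 where r1: "r1 > 0" "\<And>p. dist p x < r1 \<Longrightarrow> dist (pd i (pd j f) p) (pd i (pd j f) x) < e"
    using cont[of i j] e unfolding continuous_at_eps_delta dist_norm by metis
  obtain r2 where r2: "r2 > 0" "\<And>p. dist p x < r2 \<Longrightarrow> dist (pd j (pd i f) p) (pd j (pd i f) x) < e"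
    using cont[of j i] e unfolding continuous_at_eps_delta dist_norm by metis
  obtain r3 where r3: "r3 > 0" "ball x r3 \<subseteq> S"
    using assms openE by blast
  define r where "r = min r1 (min r2 r3)"
  have r: "r > 0" "r \<le> r1" "r \<le> r2" "ball x r \<subseteq> S"
    using r1 r2 r3 by (auto simp: r_def)
  have "0 < r / 3" "2 * (r / 3) < r" using r by auto
  note sd = second_difference_mean_value[OF sm r(4) this]
  obtain p where p: "p \<in> ball x r" and 1: "f (x + (r/3) *\<^sub>R axis i 1 + (r/3) *\<^sub>R axis j 1) - f (x + (r/3) *\<^sub>R axis i 1)
     - f (x + (r/3) *\<^sub>R axis j 1) + f x = (r/3)\<^sup>2 * pd j (pd i f) p"
    using sd by blast
  obtain q where q: "q \<in> ball x r" and 2: "f (x + (r/3) *\<^sub>R axis j 1 + (r/3) *\<^sub>R axis i 1) - f (x + (r/3) *\<^sub>R axis j 1)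
     - f (x + (r/3) *\<^sub>R axis i 1) + f x = (r/3)\<^sup>2 * pd i (pd j f) q"
    using sd by blast
  have sw: "x + (r/3) *\<^sub>R axis i 1 + (r/3) *\<^sub>R axis j 1 = x + (r/3) *\<^sub>R axis j 1 + (r/3) *\<^sub>R axis i 1"
    by simp
  have "(r/3)\<^sup>2 * pd j (pd i f) p = (r/3)\<^sup>2 * pd i (pd j f) q"
    using 1 2 unfolding sw by linarith
  then have "pd j (pd i f) p = pd i (pd j f) q" using r by simp
  moreover have "\<bar>pd j (pd i f) p - pd j (pd i f) x\<bar> < e" "\<bar>pd i (pd j f) q - pd i (pd j f) x\<bar> < e"
    using r1(2)[of q] r2(2)[of p] p q r by (auto simp: dist_commute dist_real_def)
  ultimately show False unfolding e_def by (smt (verit) field_sum_of_halves)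
qed

section \<open>Locality and rules for partial derivatives\<close>

lemma pd_cong_open:
  assumes "open S" "x \<in> S" "\<And>y. y \<in> S \<Longrightarrow> f y = g y" "f differentiable (at x)"
  shows "pd i f x = pd i g x"
  unfolding pd_def using frechet_derivative_transform_within_open[OF assms(4,1,2,3)] by simp

lemma differentiable_cong_open:
  fixes f g :: "'a::real_normed_vector \<Rightarrow> 'b::real_normed_vector"
  assumes "open S" "x \<in> S" "\<And>y. y \<in> S \<Longrightarrow> f y = g y" "f differentiable (at x)"
  shows "g differentiable (at x)"
  using assms has_derivative_transform_within_open unfolding differentiable_def by blast

context
  fixes f g :: "real^'n \<Rightarrow> real" and x
  assumes f: "f differentiable (at x)" and g: "g differentiable (at x)"
begin

lemma pd_diff: "pd i (\<lambda>x. f x - g x) x = pd i f x - pd i g x"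
  using pd_eqI[OF has_derivative_diff[OF f[unfolded frechet_derivative_works] g[unfolded frechet_derivative_works]]]
  by (simp add: pd_def)

lemma pd_mult: "pd i (\<lambda>x. f x * g x) x = pd i f x * g x + f x * pd i g x"
  using pd_eqI[OF has_derivative_mult[OF f[unfolded frechet_derivative_works] g[unfolded frechet_derivative_works]]]
  by (simp add: pd_def)

lemma pd_divide:
  assumes "g x \<noteq> 0"
  shows "pd i (\<lambda>x. f x / g x) x = pd i f x / g x - f x * pd i g x / (g x)\<^sup>2"
  using pd_eqI[OF has_derivative_divide[OF f[unfolded frechet_derivative_works] g[unfolded frechet_derivative_works] assms]]
  using assms by (simp add: pd_def field_simps power2_eq_square)

end

lemma pd_cmult:
  fixes f :: "real^'n \<Rightarrow> real"
  assumes "f differentiable (at x)"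
  shows "pd i (\<lambda>x. c * f x) x = c * pd i f x"
  using pd_mult[of "\<lambda>_. c" x f i] assms by (simp add: pd_def)

lemma pd_sum:
  fixes f :: "'a \<Rightarrow> real^'n \<Rightarrow> real"
  assumes "\<And>k. k \<in> A \<Longrightarrow> f k differentiable (at x)"
  shows "pd i (\<lambda>x. \<Sum>k\<in>A. f k x) x = (\<Sum>k\<in>A. pd i (f k) x)"
proof -
  have "((\<lambda>x. \<Sum>k\<in>A. f k x) has_derivative (\<lambda>v. \<Sum>k\<in>A. frechet_derivative (f k) (at x) v)) (at x)"
    using assms frechet_derivative_works by (intro has_derivative_sum) blast
  from pd_eqI[OF this] show ?thesis by (simp add: pd_def)
qed

section \<open>Logarithms of nonvanishing functions\<close>

lemma ln_abs: "ln \<bar>y :: real\<bar> = ln y"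
  by (simp add: abs_if ln_minus)

text \<open>The real \<open>ln\<close> is even here, hence the logarithm of the absolute value, with
  derivative \<open>1 / y\<close> on both sides of 0. This treats both signs of the Hessian
  determinant at once.\<close>

lemma DERIV_ln_nonzero:
  assumes "(y :: real) \<noteq> 0"
  shows "(ln has_real_derivative 1 / y) (at y)"
proof (cases "y > 0")
  case True
  then show ?thesis by (rule DERIV_ln_divide)
next
  case False
  have "((\<lambda>y. ln (- y)) has_real_derivative 1 / y) (at y)"
    using False assms by (auto intro!: derivative_eq_intros)
  then show ?thesis by (simp add: ln_minus)
qed

lemma pd_ln:
  fixes f :: "real^'n \<Rightarrow> real"
  assumes "f differentiable (at x)" "f x \<noteq> 0"
  shows "pd i (\<lambda>x. ln (f x)) x = pd i f x / f x" "(\<lambda>x. ln (f x)) differentiable (at x)"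
proof -
  have *: "((\<lambda>x. ln (f x)) has_derivative (\<lambda>v. (1 / f x) * frechet_derivative f (at x) v)) (at x)"
    using has_derivative_compose[OF assms(1)[unfolded frechet_derivative_works]
        DERIV_ln_nonzero[OF assms(2), unfolded has_field_derivative_def]] by simp
  show "pd i (\<lambda>x. ln (f x)) x = pd i f x / f x"
    using pd_eqI[OF *] by (simp add: pd_def)
  show "(\<lambda>x. ln (f x)) differentiable (at x)"
    using * differentiableI by blast
qed

lemma pd_pd_ln:
  fixes f :: "real^'n \<Rightarrow> real"
  assumes S: "open S" "x \<in> S" and f: "smooth_on f S" and nz: "\<And>x. x \<in> S \<Longrightarrow> f x \<noteq> 0"
  shows "pd i (pd j (\<lambda>x. ln (f x))) x = pd i (pd j f) x / f x - pd i f x * pd j f x / (f x)\<^sup>2"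
    and "pd j (\<lambda>x. ln (f x)) differentiable (at x)"
proof -
  note d = smooth_on_differentiable[OF f] smooth_on_differentiable[OF smooth_on_pd[OF f]]
  have eq: "pd j f y / f y = pd j (\<lambda>x. ln (f x)) y" if "y \<in> S" for y
    using pd_ln(1)[OF d(1) nz] that by simp
  have q: "(\<lambda>y. pd j f y / f y) differentiable (at x)"
    using d nz S by (intro differentiable_divide) auto
  show "pd j (\<lambda>x. ln (f x)) differentiable (at x)"
    by (rule differentiable_cong_open[OF S eq q])
  have "pd i (pd j (\<lambda>x. ln (f x))) x = pd i (\<lambda>y. pd j f y / f y) x"
    by (rule pd_cong_open[OF S eq q, symmetric])
  also have "\<dots> = pd i (pd j f) x / f x - pd j f x * pd i f x / (f x)\<^sup>2"
    by (rule pd_divide) (use d nz S in auto)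
  finally show "pd i (pd j (\<lambda>x. ln (f x))) x = pd i (pd j f) x / f x - pd i f x * pd j f x / (f x)\<^sup>2"
    by simp
qed

section \<open>Closure properties of continuously differentiable and smooth functions\<close>

text \<open>On an open set equal functions have equal derivatives. The lemma lets the sum and
  product rules, which hold only at points of \<open>S\<close>, be substituted under
  \<open>Ck_on\<close>.\<close>

lemma Ck_on_cong:
  assumes "open S"
  shows "Ck_on k f S \<Longrightarrow> (\<And>x. x \<in> S \<Longrightarrow> f x = g x) \<Longrightarrow> Ck_on k g S"
proof (induction k arbitrary: f g)
  case 0
  then show ?case by (metis Ck_on.simps(1) continuous_on_cong)
next
  case (Suc k)
  have d: "g differentiable (at x)" "frechet_derivative f (at x) = frechet_derivative g (at x)" if "x \<in> S" for x
  proof -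
    have f: "f differentiable (at x)" using Suc.prems(1) that by simp
    show "g differentiable (at x)"
      by (rule differentiable_cong_open[OF assms that Suc.prems(2) f])
    show "frechet_derivative f (at x) = frechet_derivative g (at x)"
      by (rule frechet_derivative_transform_within_open[OF f assms that Suc.prems(2)])
  qed
  have "Ck_on k (\<lambda>x. frechet_derivative g (at x) v) S" for v
    by (rule Suc.IH[of "\<lambda>x. frechet_derivative f (at x) v"]) (use Suc.prems d in auto)
  then show ?case using d by simp
qed

lemma Ck_on_SucD: "Ck_on (Suc k) f S \<Longrightarrow> Ck_on k f S"
proof (induction k arbitrary: f)
  case 0
  then show ?case
    by (simp add: continuous_at_imp_continuous_on differentiable_imp_continuous_within)
next
  case (Suc k)
  from Suc.prems have "\<forall>x\<in>S. f differentiable (at x)" "Ck_on (Suc k) (\<lambda>x. frechet_derivative f (at x) v) S" for v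
    unfolding Ck_on.simps(2)[of "Suc k" f] by blast+
  then show ?case
    unfolding Ck_on.simps(2)[of k f] using Suc.IH by blast
qed

lemma Ck_on_const: "Ck_on k (\<lambda>_. c) S"
  by (induction k arbitrary: c) auto

lemma Ck_on_add:
  assumes "open S"
  shows "Ck_on k f S \<Longrightarrow> Ck_on k g S \<Longrightarrow> Ck_on k (\<lambda>x. f x + g x) S"
proof (induction k arbitrary: f g)
  case 0
  then show ?case by (simp add: continuous_on_add)
next
  case (Suc k)
  have d: "f differentiable (at x)" "g differentiable (at x)" if "x \<in> S" for x
    using Suc.prems that by auto
  have eq: "frechet_derivative f (at x) v + frechet_derivative g (at x) v
      = frechet_derivative (\<lambda>x. f x + g x) (at x) v" if "x \<in> S" for x v
    using fun_cong[OF frechet_derivative_at[OF has_derivative_add[OF d[OF that, unfolded frechet_derivative_works]]], of v] by simp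
  have "Ck_on k (\<lambda>x. frechet_derivative (\<lambda>x. f x + g x) (at x) v) S" for v
    by (rule Ck_on_cong[OF assms Suc.IH eq]) (use Suc.prems in auto)
  then show ?case using d by simp
qed

text \<open>The product rule multiplies a factor of class \<open>Suc k\<close> by a derivative of
  class \<open>k\<close>; \<open>Ck_on_SucD\<close> lowers the former so that the induction
  hypothesis applies to both products.\<close>

lemma Ck_on_mult:
  fixes f g :: "'a::real_normed_vector \<Rightarrow> 'b::real_normed_algebra"
  assumes "open S"
  shows "Ck_on k f S \<Longrightarrow> Ck_on k g S \<Longrightarrow> Ck_on k (\<lambda>x. f x * g x) S"
proof (induction k arbitrary: f g)
  case 0
  then show ?case by (simp add: continuous_on_mult)
next
  case (Suc k)
  have d: "f differentiable (at x)" "g differentiable (at x)" if "x \<in> S" for x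
    using Suc.prems that by auto
  have eq: "f x * frechet_derivative g (at x) v + frechet_derivative f (at x) v * g x
      = frechet_derivative (\<lambda>x. f x * g x) (at x) v" if "x \<in> S" for x v
    using fun_cong[OF frechet_derivative_at[OF has_derivative_mult[OF d[OF that, unfolded frechet_derivative_works]]], of v] by simp
  have "Ck_on k (\<lambda>x. f x * frechet_derivative g (at x) v + frechet_derivative f (at x) v * g x) S" for v
    using Suc.prems Ck_on_SucD[OF Suc.prems(1)] Ck_on_SucD[OF Suc.prems(2)]
    by (intro Ck_on_add[OF assms] Suc.IH) auto
  from Ck_on_cong[OF assms this eq]
  have "Ck_on k (\<lambda>x. frechet_derivative (\<lambda>x. f x * g x) (at x) v) S" for v .
  then show ?case using d by simp
qed

lemma smooth_on_sum:
  assumes "open S" "\<And>i. i \<in> I \<Longrightarrow> smooth_on (f i) S"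
  shows "smooth_on (\<lambda>x. \<Sum>i\<in>I. f i x) S"
  using assms(2)
proof (induction I rule: infinite_finite_induct)
  case (insert i I)
  then show ?case
    by (simp add: smooth_on_def Ck_on_add[OF assms(1)])
qed (simp_all add: smooth_on_def Ck_on_const)

lemma smooth_on_prod:
  fixes f :: "'i \<Rightarrow> 'a::real_normed_vector \<Rightarrow> 'b::real_normed_field"
  assumes "open S" "\<And>i. i \<in> I \<Longrightarrow> smooth_on (f i) S"
  shows "smooth_on (\<lambda>x. \<Prod>i\<in>I. f i x) S"
  using assms(2)
proof (induction I rule: infinite_finite_induct)
  case (insert i I)
  then show ?case
    by (simp add: smooth_on_def Ck_on_mult[OF assms(1)])
qed (simp_all add: smooth_on_def Ck_on_const)

text \<open>By the Leibniz expansion the determinant is a polynomial in the entries.\<close>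

lemma smooth_on_det:
  fixes A :: "'a::real_normed_vector \<Rightarrow> real^'k^'k"
  assumes S: "open S" and A: "\<And>i j. smooth_on (\<lambda>x. A x $ i $ j) S"
  shows "smooth_on (\<lambda>x. det (A x)) S"
proof -
  have c: "smooth_on (\<lambda>_. c) S" for c :: real
    by (simp add: smooth_on_def Ck_on_const)
  have cmult: "smooth_on (\<lambda>x. c * f x) S" if "smooth_on f S" for c :: real and f
    using that c[of c] by (simp add: smooth_on_def Ck_on_mult[OF S])
  show ?thesis
    unfolding det_def by (intro smooth_on_sum cmult smooth_on_prod S A)
qed

section \<open>Homogeneous functions and Euler's identity\<close>

definition homogeneous_on :: "'a::real_vector set \<Rightarrow> real \<Rightarrow> ('a \<Rightarrow> real) \<Rightarrow> bool" where
  "homogeneous_on S a f \<longleftrightarrow> (\<forall>x\<in>S. \<forall>t>0. f (t *\<^sub>R x) = t powr a * f x)"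

lemma homogeneous_onD: "homogeneous_on S a f \<Longrightarrow> x \<in> S \<Longrightarrow> t > 0 \<Longrightarrow> f (t *\<^sub>R x) = t powr a * f x"
  unfolding homogeneous_on_def by blast

text \<open>Differentiate \<open>f (s *\<^sub>R x)\<close> at \<open>s = 1\<close> twice over: once
  by the chain rule, once as the power \<open>s powr a * f x\<close>, with which it agrees on the
  open ray \<open>s > 0\<close>.\<close>

lemma euler_identity:
  fixes f :: "real^'n \<Rightarrow> real"
  assumes hom: "homogeneous_on S a f" and x: "x \<in> S" and f: "f differentiable (at x)"
  shows "(\<Sum>i\<in>UNIV. x $ i * pd i f x) = a * f x"
proof -
  have "((\<lambda>s. s *\<^sub>R x) has_derivative (\<lambda>s. s *\<^sub>R x)) (at 1)"
    by (auto intro!: derivative_eq_intros)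
  from has_derivative_pd_compose[OF _ this, of f] f
  have "((\<lambda>s. f (s *\<^sub>R x)) has_derivative (\<lambda>v. \<Sum>i\<in>UNIV. (v *\<^sub>R x) $ i * pd i f x)) (at 1)"
    by simp
  then have "((\<lambda>s. f (s *\<^sub>R x)) has_real_derivative (\<Sum>i\<in>UNIV. x $ i * pd i f x)) (at 1)"
    by (simp add: has_field_derivative_def mult.assoc mult_commute_abs flip: sum_distrib_left)
  moreover have "((\<lambda>s. f (s *\<^sub>R x)) has_real_derivative a * f x) (at 1)"
  proof (rule has_field_derivative_transform_within_open[of "\<lambda>s. s powr a * f x" _ _ "{0<..}"])
    show "((\<lambda>s. s powr a * f x) has_real_derivative a * f x) (at 1)"
      by (auto intro!: derivative_eq_intros)
  qed (use homogeneous_onD[OF hom x] in auto)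
  ultimately show ?thesis by (rule DERIV_unique)
qed

text \<open>Differentiating \<open>f (t *\<^sub>R y) = t powr a * f y\<close> in \<open>y\<close> at
  fixed \<open>t\<close> produces a factor \<open>t\<close> on the left, which lowers the degree by
  one.\<close>

lemma pd_homogeneous_on:
  fixes f :: "real^'n \<Rightarrow> real"
  assumes hom: "homogeneous_on S a f" and S: "open S" "\<And>x t. x \<in> S \<Longrightarrow> t > 0 \<Longrightarrow> t *\<^sub>R x \<in> S"
    and f: "\<And>x. x \<in> S \<Longrightarrow> f differentiable (at x)"
  shows "homogeneous_on S (a - 1) (pd i f)"
  unfolding homogeneous_on_def
proof (intro ballI allI impI)
  fix x and t :: real assume x: "x \<in> S" and t: "t > 0"
  have "((\<lambda>y. t *\<^sub>R y) has_derivative (\<lambda>y. t *\<^sub>R y)) (at x)"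
    by (auto intro!: derivative_eq_intros)
  note * = has_derivative_pd_compose[OF f[OF S(2)[OF x t]] this]
  have "t * pd i f (t *\<^sub>R x) = pd i (\<lambda>y. f (t *\<^sub>R y)) x"
    unfolding pd_eqI[OF *]
    by (simp add: axis_def if_distrib[of "\<lambda>z. _ * z"] if_distrib[of "\<lambda>z. z * _"] cong: if_cong)
  also have "\<dots> = pd i (\<lambda>y. t powr a * f y) x"
    using * t homogeneous_onD[OF hom] unfolding differentiable_def
    by (intro pd_cong_open[OF S(1) x]) (auto simp: differentiable_def)
  also have "\<dots> = t powr a * pd i f x"
    using f[OF x] by (rule pd_cmult)
  finally show "pd i f (t *\<^sub>R x) = t powr (a - 1) * pd i f x"
    using t by (simp add: powr_diff field_simps)
qed

section \<open>Derivatives of determinants and inverse matrices\<close>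

lemma matrix_inv_eqI:
  fixes A :: "'a::field^'n^'n"
  assumes "A ** B = mat 1"
  shows "matrix_inv A = B"
proof -
  have BA: "B ** A = mat 1" using assms matrix_left_right_inverse by blast
  have *: "A ** matrix_inv A = mat 1 \<and> matrix_inv A ** A = mat 1"
    unfolding matrix_inv_def
    by (rule someI[of "\<lambda>B. A ** B = mat 1 \<and> B ** A = mat 1" B]) (simp add: assms BA)
  have "matrix_inv A = (B ** A) ** matrix_inv A"
    by (simp add: BA)
  also have "\<dots> = B ** (A ** matrix_inv A)"
    by (simp only: matrix_mul_assoc)
  finally show ?thesis using * by simp
qed

lemma matrix_inv_works:
  fixes A :: "'a::field^'n^'n"
  assumes "det A \<noteq> 0"
  shows "A ** matrix_inv A = mat 1" "matrix_inv A ** A = mat 1"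
proof -
  obtain B where "A ** B = mat 1"
    using assms invertible_det_nz[of A] unfolding invertible_def by blast
  then show "A ** matrix_inv A = mat 1" using matrix_inv_eqI by metis
  then show "matrix_inv A ** A = mat 1" using matrix_left_right_inverse by blast
qed

text \<open>Column \<open>l\<close> of the inverse solves the linear system with right-hand side
  \<open>axis l 1\<close>. Writing the entries as quotients of determinants makes their
  differentiability accessible.\<close>

lemma matrix_inv_cramer:
  fixes A :: "'a::field^'n^'n"
  assumes "det A \<noteq> 0"
  shows "matrix_inv A $ k $ l = det (\<chi> i j. if j = k then axis l 1 $ i else A $ i $ j) / det A"
proof -
  have "A *v (matrix_inv A *v axis l 1) = axis l 1"
    using matrix_inv_works(1)[OF assms] by (metis matrix_vector_mul_assoc matrix_vector_mul_lid)
  then have "(matrix_inv A *v axis l 1) $ k = det (\<chi> i j. if j = k then axis l 1 $ i else A $ i $ j) / det A"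
    using cramer[OF assms, of "matrix_inv A *v axis l 1" "axis l 1"] by (metis (no_types, lifting) vec_lambda_beta)
  then show ?thesis
    by (simp add: matrix_vector_mult_def axis_def if_distrib[of "\<lambda>z. _ * z"] cong: if_cong)
qed

section \<open>Jacobi's formula and differentiability of the inverse matrix\<close>

context
  fixes A :: "real^'n \<Rightarrow> real^'k^'k" and x
  assumes A: "\<And>i j. (\<lambda>x. A x $ i $ j) differentiable (at x)"
begin

text \<open>The product rule in the Leibniz expansion differentiates one factor at a time, that is,
  one row at a time.\<close>

lemma pd_det_rows:
  "(\<lambda>x. det (A x)) differentiable (at x)"
  "pd m (\<lambda>x. det (A x)) x = (\<Sum>i\<in>UNIV. det (\<chi> k. if k = i then (\<chi> j. pd m (\<lambda>x. A x $ i $ j) x) else A x $ k))"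
proof -
  let ?P = "{p. p permutes (UNIV :: 'k set)}"
  let ?d = "\<lambda>i j. frechet_derivative (\<lambda>x. A x $ i $ j) (at x)"
  have *: "((\<lambda>x. det (A x)) has_derivative (\<lambda>v. \<Sum>p\<in>?P. of_int (sign p) *
      (\<Sum>i\<in>UNIV. ?d i (p i) v * (\<Prod>j\<in>UNIV - {i}. A x $ j $ p j)))) (at x)"
    unfolding det_def
    by (intro has_derivative_sum has_derivative_mult_right has_derivative_prod A[unfolded frechet_derivative_works])
  show "(\<lambda>x. det (A x)) differentiable (at x)"
    using * differentiableI by blast
  have "(\<Prod>j\<in>UNIV. (\<chi> k. if k = i then v else A x $ k) $ j $ p j) = v $ p i * (\<Prod>j\<in>UNIV - {i}. A x $ j $ p j)" for i v p
  proof -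
    have "(\<Prod>j\<in>UNIV - {i}. (\<chi> k. if k = i then v else A x $ k) $ j $ p j) = (\<Prod>j\<in>UNIV - {i}. A x $ j $ p j)"
      by (intro prod.cong) auto
    then show ?thesis by (subst prod.remove[of _ i]) auto
  qed
  note prod_row = this
  show "pd m (\<lambda>x. det (A x)) x = (\<Sum>i\<in>UNIV. det (\<chi> k. if k = i then (\<chi> j. pd m (\<lambda>x. A x $ i $ j) x) else A x $ k))"
    unfolding pd_eqI[OF *]
    unfolding det_def prod_row by (simp add: sum_distrib_left pd_def sum.swap[of _ UNIV])
qed

theorem pd_det:
  assumes B: "B ** A x = mat 1"
  shows "pd m (\<lambda>x. det (A x)) x = det (A x) * (\<Sum>i\<in>UNIV. \<Sum>j\<in>UNIV. B $ i $ j * pd m (\<lambda>x. A x $ j $ i) x)"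
proof -
  define dA where "dA = (\<chi> i j. pd m (\<lambda>x. A x $ i $ j) x)"
  have dA_nth: "(\<chi> j. pd m (\<lambda>x. A x $ i $ j) x) = dA $ i" for i
    by (simp add: dA_def)
  have "det (\<chi> k. if k = i then dA $ i else A x $ k) = (dA ** B) $ i $ i * det (A x)" for i
  proof -
    \<comment> \<open>Row \<open>i\<close> of \<open>dA\<close> is a combination of the rows of
      \<open>A x\<close>, with coefficients from row \<open>i\<close> of \<open>dA ** B\<close>. Put
      in place of row \<open>i\<close>, only its own multiple of that row contributes to the
      determinant.\<close>
    have "(\<Sum>k\<in>UNIV. (dA ** B) $ i $ k *s row k (A x)) = ((dA ** B) ** A x) $ i"
      by (simp add: vec_eq_iff matrix_matrix_mult_def row_def)
    also have "\<dots> = dA $ i"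
      by (simp add: matrix_mul_assoc[symmetric] B)
    finally show ?thesis
      using cramer_lemma_transpose[of i "(dA ** B) $ i" "A x"] by (simp add: row_def cong: if_cong)
  qed
  then have "pd m (\<lambda>x. det (A x)) x = (\<Sum>i\<in>UNIV. (dA ** B) $ i $ i * det (A x))"
    unfolding pd_det_rows(2) dA_nth by simp
  also have "\<dots> = det (A x) * (\<Sum>i\<in>UNIV. \<Sum>j\<in>UNIV. dA $ i $ j * B $ j $ i)"
    by (simp add: matrix_matrix_mult_def sum_distrib_left mult.commute)
  finally show ?thesis
    by (subst sum.swap) (simp add: dA_def mult.commute)
qed

end

lemma differentiable_det:
  fixes A :: "real^'n \<Rightarrow> real^'k^'k"
  shows "(\<And>i j. (\<lambda>x. A x $ i $ j) differentiable (at x)) \<Longrightarrow> (\<lambda>x. det (A x)) differentiable (at x)"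
  by (rule pd_det_rows(1))

text \<open>Cramer's formula describes the inverse where the determinant is nonzero; asking this on
  an open set makes the formula valid near \<open>x\<close>, as differentiation requires.\<close>

lemma differentiable_matrix_inv:
  fixes A :: "real^'n \<Rightarrow> real^'k^'k"
  assumes A: "\<And>y i j. y \<in> S \<Longrightarrow> (\<lambda>x. A x $ i $ j) differentiable (at y)"
    and S: "open S" "x \<in> S" "\<And>y. y \<in> S \<Longrightarrow> det (A y) \<noteq> 0"
  shows "(\<lambda>x. matrix_inv (A x) $ k $ l) differentiable (at x)"
proof (rule differentiable_cong_open[OF S(1,2)])
  show "(\<lambda>x. det (\<chi> i j. if j = k then axis l 1 $ i else A x $ i $ j) / det (A x)) differentiable (at x)"
  proof (intro differentiable_divide differentiable_det)
    show "(\<lambda>x. (\<chi> i j. if j = k then axis l 1 $ i else A x $ i $ j) $ i $ j) differentiable (at x)" for i j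
      using A[OF S(2)] by (cases "j = k") auto
  qed (use A S(2) in \<open>simp_all add: S(3)\<close>)
qed (simp_all add: matrix_inv_cramer S(3) A S(2))

section \<open>Tube domains\<close>

lemma has_derivative_Im_vec: "(Im_vec has_derivative Im_vec) (at (z :: complex^'n))"
proof -
  have "linear (Im_vec :: complex^'n \<Rightarrow> _)"
    by (rule linearI) (auto simp: Im_vec_def vec_eq_iff)
  then show ?thesis
    by (simp add: bounded_linear_imp_has_derivative linear_conv_bounded_linear)
qed

lemma Im_vec_nth [simp]: "Im_vec v $ i = Im (v $ i)"
  by (simp add: Im_vec_def)

lemma open_tube:
  fixes U :: "(real^'n) set"
  assumes "open U"
  shows "open (tube U)"
proof -
  have "isCont Im_vec z" for z :: "complex^'n"
    using has_derivative_continuous[OF has_derivative_Im_vec] .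
  then have "continuous_on UNIV (Im_vec :: complex^'n \<Rightarrow> _)"
    by (simp add: continuous_on_eq_continuous_at)
  from open_vimage[OF assms this] show ?thesis
    by (simp add: vimage_def tube_def)
qed

lemma has_derivative_Im_vec_compose:
  fixes f :: "real^'n \<Rightarrow> real"
  assumes "f differentiable (at (Im_vec z))"
  shows "((\<lambda>p. f (Im_vec p)) has_derivative (\<lambda>v. \<Sum>i\<in>UNIV. Im (v $ i) * pd i f (Im_vec z))) (at z)"
  using has_derivative_pd_compose[OF assms has_derivative_Im_vec] by simp

text \<open>On functions of \<open>x = Im z\<close>, the operators \<partial>/\<partial>z and its
  conjugate act as -i/2 and i/2 times \<partial>/\<partial>x. The complex constant \<open>c\<close>
  is there because the result of a first derivative is i/2 times a real function, to be
  differentiated again.\<close>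

lemma pdz_pdzbar_Im_vec:
  fixes f :: "real^'n \<Rightarrow> real"
  assumes "f differentiable (at (Im_vec z))"
  shows "pdz \<mu> (\<lambda>p. c * complex_of_real (f (Im_vec p))) z = - \<i> / 2 * c * complex_of_real (pd \<mu> f (Im_vec z))"
    and "pdzbar \<mu> (\<lambda>p. c * complex_of_real (f (Im_vec p))) z = \<i> / 2 * c * complex_of_real (pd \<mu> f (Im_vec z))"
proof -
  have *: "((\<lambda>p. c * complex_of_real (f (Im_vec p))) has_derivative
      (\<lambda>v. c * complex_of_real (\<Sum>i\<in>UNIV. Im (v $ i) * pd i f (Im_vec z)))) (at z)"
    by (intro has_derivative_mult_right has_derivative_of_real has_derivative_Im_vec_compose assms)
  note eq = frechet_derivative_at[OF *, symmetric]
  show "pdz \<mu> (\<lambda>p. c * complex_of_real (f (Im_vec p))) z = - \<i> / 2 * c * complex_of_real (pd \<mu> f (Im_vec z))"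
    and "pdzbar \<mu> (\<lambda>p. c * complex_of_real (f (Im_vec p))) z = \<i> / 2 * c * complex_of_real (pd \<mu> f (Im_vec z))"
    unfolding pdz_def pdzbar_def eq cext_def del_z_def del_zbar_def
    by (simp_all add: axis_def if_distrib[of "\<lambda>z. z * _"] if_distrib[of Im] if_distrib[of "\<lambda>z. _ * z"]
        sum_negf cong: if_cong)
qed

lemma pdz_pdzbar_hessian:
  fixes f :: "real^'n \<Rightarrow> real"
  assumes U: "open U" "z \<in> tube U" and f: "\<And>x. x \<in> U \<Longrightarrow> f differentiable (at x)"
    and f': "\<And>x. x \<in> U \<Longrightarrow> pd \<nu> f differentiable (at x)"
  shows "pdz \<mu> (pdzbar \<nu> (\<lambda>p. complex_of_real (f (Im_vec p)))) z
    = complex_of_real (1/4 * pd \<mu> (pd \<nu> f) (Im_vec z))"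
proof -
  have z: "Im_vec z \<in> U" using U by (simp add: tube_def)
  have eq: "\<i> / 2 * complex_of_real (pd \<nu> f (Im_vec p)) = pdzbar \<nu> (\<lambda>p. complex_of_real (f (Im_vec p))) p"
    if "p \<in> tube U" for p
    using pdz_pdzbar_Im_vec(2)[of f p \<nu> 1] f that by (simp add: tube_def)
  have "(\<lambda>p. \<i> / 2 * complex_of_real (pd \<nu> f (Im_vec p))) differentiable (at z)"
    using has_derivative_mult_right[OF has_derivative_of_real[OF has_derivative_Im_vec_compose[OF f'[OF z]]]]
      differentiableI by blast
  from frechet_derivative_transform_within_open[OF this open_tube[OF U(1)] U(2) eq]
  have "pdz \<mu> (pdzbar \<nu> (\<lambda>p. complex_of_real (f (Im_vec p)))) z
      = pdz \<mu> (\<lambda>p. \<i> / 2 * complex_of_real (pd \<nu> f (Im_vec p))) z"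
    by (simp add: pdz_def)
  then show ?thesis
    using pdz_pdzbar_Im_vec(1)[of "pd \<nu> f" z \<mu> "\<i> / 2"] f'[OF z] by simp
qed

lemma has_derivative_vec_lambda:
  fixes f :: "'k::finite \<Rightarrow> 'a::real_normed_vector \<Rightarrow> 'b::euclidean_space"
  assumes "\<And>i. (f i has_derivative f' i) F"
  shows "((\<lambda>p. \<chi> i. f i p) has_derivative (\<lambda>v. \<chi> i. f' i v)) F"
proof -
  have "linear (\<lambda>c::'b. axis i c :: 'b^'k)" for i
    by (rule linearI) (auto simp: axis_def vec_eq_iff)
  then have bl: "bounded_linear (\<lambda>c::'b. axis i c :: 'b^'k)" for i
    by (simp add: linear_conv_bounded_linear)
  have "((\<lambda>p. \<Sum>i\<in>UNIV. axis i (f i p)) has_derivative (\<lambda>v. \<Sum>i\<in>UNIV. axis i (f' i v))) F"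
    by (intro has_derivative_sum bounded_linear.has_derivative[OF bl] assms)
  moreover have "(\<Sum>i\<in>UNIV. axis i (c i)) = (\<chi> i. c i)" for c :: "'k \<Rightarrow> 'b"
    by (simp add: vec_eq_iff sum_component axis_def)
  ultimately show ?thesis by simp
qed

section \<open>Uniqueness of the Levi-Civita connection\<close>

text \<open>The difference \<open>K\<close> of the two lowered connections is symmetric in its first
  two arguments and antisymmetric in the last two. Alternating these swaps gives
  \<open>K = - K\<close>, and nondegeneracy finishes. This is what gives the \<open>THE\<close> in
  \<open>christoffel\<close> a value.\<close>

lemma levi_civita_at_unique:
  fixes g :: "'a::real_normed_vector \<Rightarrow> 'a \<Rightarrow> 'a \<Rightarrow> real"
  assumes 1: "levi_civita_at g z \<Gamma>" and 2: "levi_civita_at g z \<Gamma>'"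
    and lin: "\<And>w. linear (\<lambda>v. g z v w)" and sym: "\<And>v w. g z v w = g z w v"
    and nondeg: "\<And>v. (\<And>w. g z v w = 0) \<Longrightarrow> v = 0"
  shows "\<Gamma> = \<Gamma>'"
proof (intro ext)
  fix u v
  define K where "K u v w = g z (\<Gamma> u v) w - g z (\<Gamma>' u v) w" for u v w
  have K1: "K u v w = K v u w" for u v w
    using 1 2 unfolding levi_civita_at_def K_def by metis
  have "g z (\<Gamma> u v) w + g z v (\<Gamma> u w) = g z (\<Gamma>' u v) w + g z v (\<Gamma>' u w)" for u v w
    using 1 2 unfolding levi_civita_at_def by metis
  then have K2: "K u v w = - K u w v" for u v w
    unfolding K_def using sym by (smt (verit))
  have "K u v w = 0" for w
    using K1 K2 by (smt (verit))
  then have "g z (\<Gamma> u v - \<Gamma>' u v) w = 0" for w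
    by (simp add: linear_diff[OF lin] K_def)
  from nondeg[OF this] show "\<Gamma> u v = \<Gamma>' u v" by simp
qed

section \<open>Evaluation on the complexified coordinate fields\<close>

lemma cext_add: "cext (\<lambda>v. \<phi> v + \<psi> v) w = cext \<phi> w + cext \<psi> w"
  by (simp add: cext_def algebra_simps)

lemma scaleR_axis_ii: "c *\<^sub>R axis \<mu> \<i> = (complex_of_real c * \<i>) *s axis \<mu> 1"
  "c *\<^sub>R axis \<mu> 1 = complex_of_real c *s axis \<mu> 1"
  by (auto simp: axis_def vec_eq_iff complex_eq_iff)

text \<open>A complex-linear map is a form of type (1,0): its two halves on \<partial>/\<partial>z
  agree and add up, while in \<open>cext_del_zbar\<close> they cancel.\<close>

lemma cext_del_z:
  assumes "\<And>c v. \<phi> (c *s v) = c * \<phi> v"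
  shows "cext \<phi> (del_z \<mu>) = \<phi> (axis \<mu> 1)"
proof -
  have "\<phi> (- v) = - \<phi> v" for v
    using assms[of "-1" v] by simp
  then show ?thesis
    by (simp add: cext_def del_z_def scaleR_axis_ii assms)
qed

lemma cext_del_zbar:
  assumes "\<And>c v. \<phi> (c *s v) = c * \<phi> v"
  shows "cext \<phi> (del_zbar \<mu>) = 0"
  by (simp add: cext_def del_zbar_def scaleR_axis_ii assms)

text \<open>The form dx of a coordinate is only real-linear, and takes the value i/2 on the
  conjugate field of the same index.\<close>

lemma cext_Im_del_zbar:
  "cext (\<lambda>v. \<Sum>k\<in>UNIV. complex_of_real (Im (v $ k)) * B k) (del_zbar \<mu>) = \<i> / 2 * B \<mu>"
  by (simp add: cext_def del_zbar_def axis_def if_distrib[of Im] if_distrib[of of_real]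
      if_distrib[of "\<lambda>z. z * _"] if_distrib[of "\<lambda>z. _ * z"] cong: if_cong)

section \<open>Curvature of metrics on a tube\<close>

text \<open>\<open>dG_sym\<close> is the Kaehler condition for a metric whose coefficients are real
  and depend on \<open>x\<close> alone; with \<open>G_sym\<close> it makes the first derivatives of
  \<open>G\<close> totally symmetric. \<open>G_det\<close> serves both to invert \<open>G\<close>
  and to make \<open>g\<close> nondegenerate.\<close>

locale tube_metric =
  fixes U :: "(real^'n) set" and G :: "real^'n \<Rightarrow> real^'n^'n"
    and g :: "complex^'n \<Rightarrow> complex^'n \<Rightarrow> complex^'n \<Rightarrow> real"
  assumes open_U: "open U"
    and G_sym: "x \<in> U \<Longrightarrow> G x $ i $ j = G x $ j $ i"
    and G_det: "x \<in> U \<Longrightarrow> det (G x) \<noteq> 0"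
    and G_diff: "x \<in> U \<Longrightarrow> (\<lambda>x. G x $ i $ j) differentiable (at x)"
    and dG_diff: "x \<in> U \<Longrightarrow> pd m (\<lambda>x. G x $ i $ j) differentiable (at x)"
    and dG_sym: "x \<in> U \<Longrightarrow> pd m (\<lambda>x. G x $ i $ j) x = pd i (\<lambda>x. G x $ m $ j) x"
    and g_eq: "z \<in> tube U \<Longrightarrow>
      g z v w = (\<Sum>\<mu>\<in>UNIV. \<Sum>\<nu>\<in>UNIV. G (Im_vec z) $ \<mu> $ \<nu> * (2 * Re (v $ \<mu> * cnj (w $ \<nu>))))"
begin

section \<open>The connection of a tube metric\<close>

definition C :: "'n \<Rightarrow> 'n \<Rightarrow> 'n \<Rightarrow> real^'n \<Rightarrow> real" where
  "C r m s x = 1/2 * (\<Sum>l\<in>UNIV. matrix_inv (G x) $ r $ l * pd m (\<lambda>x. G x $ l $ s) x)"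

definition Gam :: "real^'n \<Rightarrow> complex^'n \<Rightarrow> complex^'n \<Rightarrow> complex^'n" where
  "Gam x u v = (\<chi> r. - \<i> * (\<Sum>m\<in>UNIV. \<Sum>s\<in>UNIV. complex_of_real (C r m s x) * (u $ m * v $ s)))"

text \<open>The derivative of \<open>Gam\<close> at \<open>x\<close> along \<open>u\<close>. Since
  \<open>C\<close> depends on \<open>x\<close> alone, only \<open>Im\<close> of \<open>u\<close>
  enters: the expression is complex-linear in \<open>v\<close> and \<open>w\<close> but merely
  real-linear in \<open>u\<close>.\<close>

definition dGam :: "real^'n \<Rightarrow> complex^'n \<Rightarrow> complex^'n \<Rightarrow> complex^'n \<Rightarrow> complex^'n" where
  "dGam x u v w = (\<chi> r. - \<i> * (\<Sum>m\<in>UNIV. \<Sum>s\<in>UNIV.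
     complex_of_real (\<Sum>k\<in>UNIV. Im (u $ k) * pd k (C r m s) x) * (v $ m * w $ s)))"

lemma dG_symmetric: "x \<in> U \<Longrightarrow> pd m (\<lambda>x. G x $ i $ j) x = pd m (\<lambda>x. G x $ j $ i) x"
  using pd_cong_open[OF open_U _ G_sym G_diff] .

lemma C_sym: "x \<in> U \<Longrightarrow> C r m s x = C r s m x"
proof -
  assume x: "x \<in> U"
  have "pd m (\<lambda>x. G x $ l $ s) x = pd s (\<lambda>x. G x $ l $ m) x" for l
    using dG_symmetric[OF x] dG_sym[OF x] by metis
  then show ?thesis by (simp add: C_def)
qed

lemma C_diff: "x \<in> U \<Longrightarrow> C r m s differentiable (at x)"
  unfolding C_def
  by (intro differentiable_mult differentiable_const differentiable_sum ballI dG_diff finite_UNIV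
      differentiable_matrix_inv[OF G_diff open_U _ G_det]) auto

lemma G_C: "x \<in> U \<Longrightarrow> (\<Sum>r\<in>UNIV. G x $ n $ r * C r m s x) = 1/2 * pd m (\<lambda>x. G x $ n $ s) x"
proof -
  assume x: "x \<in> U"
  define t where "t = (\<chi> l. pd m (\<lambda>x. G x $ l $ s) x)"
  have "(G x *v (matrix_inv (G x) *v t)) = t"
    using matrix_inv_works(1)[OF G_det[OF x]] by (simp add: matrix_vector_mul_assoc)
  then have "(G x *v (matrix_inv (G x) *v t)) $ n = t $ n" by simp
  then show ?thesis
    by (simp add: t_def C_def matrix_vector_mult_def flip: sum_divide_distrib)
qed

lemma Gam_scale: "Gam x (c *s u) v = c *s Gam x u v" "Gam x u (c *s v) = c *s Gam x u v"
  by (simp_all add: Gam_def vec_eq_iff sum_distrib_left mult_ac)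

lemma Gam_add: "Gam x (u + u') v = Gam x u v + Gam x u' v" "Gam x u (v + v') = Gam x u v + Gam x u v'"
  by (simp_all add: Gam_def vec_eq_iff algebra_simps sum.distrib)

lemma scaleR_scalar: "c *\<^sub>R (u :: complex^'n) = complex_of_real c *s u"
  unfolding vec_eq_iff by (simp add: scaleR_conv_of_real[where 'a=complex])

lemma bilinear_Gam: "bilinear (Gam x)"
  unfolding bilinear_def by (auto intro!: linearI simp: Gam_add scaleR_scalar Gam_scale)

lemma Gam_sym: "x \<in> U \<Longrightarrow> Gam x u v = Gam x v u"
  unfolding Gam_def vec_eq_iff
  by (simp add: C_sym[of x] mult.commute[of "u $ _"]) (subst sum.swap, simp add: C_sym[of x])

lemma g_sym: "z \<in> tube U \<Longrightarrow> g z v w = g z w v"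
proof -
  assume z: "z \<in> tube U"
  then have x: "Im_vec z \<in> U" by (simp add: tube_def)
  have "G (Im_vec z) $ i $ j * (2 * Re (v $ i * cnj (w $ j))) = G (Im_vec z) $ j $ i * (2 * Re (w $ j * cnj (v $ i)))" for i j
    by (subst G_sym[OF x]) (simp add: mult.commute)
  then show ?thesis
    unfolding g_eq[OF z] by (subst sum.swap) simp
qed

lemma linear_g: "z \<in> tube U \<Longrightarrow> linear (\<lambda>v. g z v w)"
  unfolding g_eq by (rule linearI) (simp_all add: sum.distrib sum_distrib_left algebra_simps)

text \<open>Pairing with \<open>axis k 1\<close> and \<open>axis k \<i>\<close> separates real and
  imaginary parts of \<open>v\<close>; each part lies in the kernel of the invertible matrix
  \<open>G\<close>.\<close>

lemma g_nondegenerate: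
  assumes z: "z \<in> tube U" and v: "\<And>w. g z v w = 0"
  shows "v = 0"
proof -
  let ?G = "G (Im_vec z)"
  have x: "Im_vec z \<in> U" using z by (simp add: tube_def)
  have kernel: "a = 0" if "\<And>k. (\<Sum>i\<in>UNIV. ?G $ i $ k * a $ i) = 0" for a :: "real^'n"
  proof -
    have "?G *v a = 0"
      using that by (simp add: vec_eq_iff matrix_vector_mult_def G_sym[OF x, of _ "_ :: 'n"])
    then show ?thesis
      by (metis matrix_inv_works(2)[OF G_det[OF x]] matrix_vector_mul_assoc matrix_vector_mul_lid
          matrix_vector_mult_0_right)
  qed
  have "(\<Sum>i\<in>UNIV. ?G $ i $ k * Re (v $ i)) = 0" "(\<Sum>i\<in>UNIV. ?G $ i $ k * Im (v $ i)) = 0" for k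
    using v[of "axis k 1"] v[of "axis k \<i>"]
    by (simp_all add: g_eq[OF z] axis_def if_distrib[of "\<lambda>z. _ * z"] if_distrib[of Re] if_distrib[of Im]
        if_distrib[of cnj] mult_ac flip: sum_distrib_left cong: if_cong)
  then have "(\<chi> i. Re (v $ i)) = 0" "(\<chi> i. Im (v $ i)) = 0"
    by (intro kernel; simp)+
  then show ?thesis
    by (simp add: vec_eq_iff complex_eq_iff)
qed

text \<open>The factor -i in \<open>Gam\<close> turns the real part in \<open>g\<close> into an
  imaginary part, and \<open>G_C\<close> lowers the index, its 1/2 cancelling the 2 in
  \<open>g_eq\<close>.\<close>

lemma g_Gam:
  assumes z: "z \<in> tube U"
  shows "g z (Gam (Im_vec z) u v) w = (\<Sum>n\<in>UNIV. \<Sum>m\<in>UNIV. \<Sum>s\<in>UNIV.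
    pd m (\<lambda>x. G x $ n $ s) (Im_vec z) * Im (u $ m * v $ s * cnj (w $ n)))"
proof -
  let ?x = "Im_vec z"
  have x: "?x \<in> U" using z by (simp add: tube_def)
  have Re: "Re (Gam ?x u v $ r * cnj c) = (\<Sum>m\<in>UNIV. \<Sum>s\<in>UNIV. C r m s ?x * Im (u $ m * v $ s * cnj c))" for r c
  proof -
    have "Re (Gam ?x u v $ r * cnj c) = Im ((\<Sum>m\<in>UNIV. \<Sum>s\<in>UNIV. complex_of_real (C r m s ?x) * (u $ m * v $ s)) * cnj c)"
      unfolding Gam_def by simp
    also have "\<dots> = (\<Sum>m\<in>UNIV. \<Sum>s\<in>UNIV. C r m s ?x * Im (u $ m * v $ s * cnj c))"
      unfolding sum_distrib_right Im_sum by (intro sum.cong refl) (simp add: algebra_simps)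
    finally show ?thesis .
  qed
  have "g z (Gam ?x u v) w = (\<Sum>n\<in>UNIV. \<Sum>r\<in>UNIV. \<Sum>m\<in>UNIV. \<Sum>s\<in>UNIV.
      G ?x $ r $ n * (2 * (C r m s ?x * Im (u $ m * v $ s * cnj (w $ n)))))"
    unfolding g_eq[OF z] Re by (subst sum.swap) (simp only: sum_distrib_left)
  also have "\<dots> = (\<Sum>n\<in>UNIV. \<Sum>m\<in>UNIV. \<Sum>s\<in>UNIV. \<Sum>r\<in>UNIV.
      G ?x $ r $ n * (2 * (C r m s ?x * Im (u $ m * v $ s * cnj (w $ n)))))"
    by (rule sum.cong[OF refl], subst sum.swap, rule sum.cong[OF refl], rule sum.swap)
  also have "\<dots> = (\<Sum>n\<in>UNIV. \<Sum>m\<in>UNIV. \<Sum>s\<in>UNIV.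
      pd m (\<lambda>x. G x $ n $ s) ?x * Im (u $ m * v $ s * cnj (w $ n)))"
  proof (intro sum.cong refl)
    fix n m s
    have "(\<Sum>r\<in>UNIV. G ?x $ r $ n * (2 * (C r m s ?x * Im (u $ m * v $ s * cnj (w $ n)))))
      = 2 * (\<Sum>r\<in>UNIV. G ?x $ n $ r * C r m s ?x) * Im (u $ m * v $ s * cnj (w $ n))"
      unfolding sum_distrib_left sum_distrib_right
      by (intro sum.cong refl) (simp add: G_sym[OF x, of n] mult_ac del: times_complex.sel complex_mult)
    then show "(\<Sum>r\<in>UNIV. G ?x $ r $ n * (2 * (C r m s ?x * Im (u $ m * v $ s * cnj (w $ n)))))
      = pd m (\<lambda>x. G x $ n $ s) ?x * Im (u $ m * v $ s * cnj (w $ n))"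
      unfolding G_C[OF x] by simp
  qed
  finally show ?thesis .
qed

lemma frechet_derivative_g:
  assumes z: "z \<in> tube U"
  shows "frechet_derivative (\<lambda>p. g p v w) (at z) u = (\<Sum>\<mu>\<in>UNIV. \<Sum>\<nu>\<in>UNIV.
    (\<Sum>k\<in>UNIV. Im (u $ k) * pd k (\<lambda>x. G x $ \<mu> $ \<nu>) (Im_vec z)) * (2 * Re (v $ \<mu> * cnj (w $ \<nu>))))"
proof -
  have x: "Im_vec z \<in> U" using z by (simp add: tube_def)
  have *: "((\<lambda>p. \<Sum>\<mu>\<in>UNIV. \<Sum>\<nu>\<in>UNIV. G (Im_vec p) $ \<mu> $ \<nu> * (2 * Re (v $ \<mu> * cnj (w $ \<nu>)))) has_derivative
    (\<lambda>u. \<Sum>\<mu>\<in>UNIV. \<Sum>\<nu>\<in>UNIV. (\<Sum>k\<in>UNIV. Im (u $ k) * pd k (\<lambda>x. G x $ \<mu> $ \<nu>) (Im_vec z)) *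
       (2 * Re (v $ \<mu> * cnj (w $ \<nu>))))) (at z)"
    by (intro has_derivative_sum has_derivative_mult_left has_derivative_Im_vec_compose G_diff x)
  have "((\<lambda>p. g p v w) has_derivative
    (\<lambda>u. \<Sum>\<mu>\<in>UNIV. \<Sum>\<nu>\<in>UNIV. (\<Sum>k\<in>UNIV. Im (u $ k) * pd k (\<lambda>x. G x $ \<mu> $ \<nu>) (Im_vec z)) *
       (2 * Re (v $ \<mu> * cnj (w $ \<nu>))))) (at z)"
    by (rule has_derivative_transform_within_open[OF * open_tube[OF open_U] z]) (simp only: g_eq)
  from fun_cong[OF frechet_derivative_at[OF this, symmetric]] show ?thesis .
qed

lemma levi_civita_Gam:
  assumes z: "z \<in> tube U"
  shows "levi_civita_at g z (Gam (Im_vec z))"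
  unfolding levi_civita_at_def
proof (intro conjI allI)
  let ?x = "Im_vec z"
  have x: "?x \<in> U" using z by (simp add: tube_def)
  show "bilinear (Gam ?x)" by (rule bilinear_Gam)
  show "Gam ?x u v = Gam ?x v u" for u v by (rule Gam_sym[OF x])
  fix u v w
  let ?T = "\<lambda>m n s. pd m (\<lambda>x. G x $ n $ s) ?x"
  have "g z (Gam ?x u v) w + g z v (Gam ?x u w) = g z (Gam ?x u v) w + g z (Gam ?x u w) v"
    using g_sym[OF z] by simp
  \<comment> \<open>Renaming indices by the symmetry of \<open>?T\<close> gives both summands the
    same coefficient \<open>?T m n s\<close>.\<close>
  also have "g z (Gam ?x u w) v = (\<Sum>n\<in>UNIV. \<Sum>m\<in>UNIV. \<Sum>s\<in>UNIV. ?T m n s * Im (u $ m * w $ n * cnj (v $ s)))"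
  proof -
    have "g z (Gam ?x u w) v = (\<Sum>s\<in>UNIV. \<Sum>m\<in>UNIV. \<Sum>n\<in>UNIV. ?T m n s * Im (u $ m * w $ n * cnj (v $ s)))"
      unfolding g_Gam[OF z] by (intro sum.cong refl) (metis dG_symmetric[OF x])
    also have "\<dots> = (\<Sum>s\<in>UNIV. \<Sum>n\<in>UNIV. \<Sum>m\<in>UNIV. ?T m n s * Im (u $ m * w $ n * cnj (v $ s)))"
      by (rule sum.cong[OF refl], rule sum.swap)
    also have "\<dots> = (\<Sum>n\<in>UNIV. \<Sum>s\<in>UNIV. \<Sum>m\<in>UNIV. ?T m n s * Im (u $ m * w $ n * cnj (v $ s)))"
      by (rule sum.swap)
    also have "\<dots> = (\<Sum>n\<in>UNIV. \<Sum>m\<in>UNIV. \<Sum>s\<in>UNIV. ?T m n s * Im (u $ m * w $ n * cnj (v $ s)))"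
      by (rule sum.cong[OF refl], rule sum.swap)
    finally show ?thesis .
  qed
  \<comment> \<open>For complex a, b, c, Im (a b cnj c) + Im (a c cnj b) = 2 Im a Re (b cnj c),
    because b cnj c + c cnj b is real.\<close>
  also have "g z (Gam ?x u v) w + (\<Sum>n\<in>UNIV. \<Sum>m\<in>UNIV. \<Sum>s\<in>UNIV. ?T m n s * Im (u $ m * w $ n * cnj (v $ s)))
    = (\<Sum>n\<in>UNIV. \<Sum>m\<in>UNIV. \<Sum>s\<in>UNIV. Im (u $ m) * ?T m n s * (2 * Re (v $ s * cnj (w $ n))))"
    unfolding g_Gam[OF z] sum.distrib[symmetric]
    by (intro sum.cong refl) (simp add: algebra_simps)
  also have "\<dots> = (\<Sum>n\<in>UNIV. \<Sum>m\<in>UNIV. \<Sum>s\<in>UNIV. Im (u $ m) * ?T m s n * (2 * Re (v $ s * cnj (w $ n))))"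
    by (intro sum.cong refl) (subst dG_symmetric[OF x], rule refl)
  also have "\<dots> = (\<Sum>n\<in>UNIV. \<Sum>s\<in>UNIV. \<Sum>m\<in>UNIV. Im (u $ m) * ?T m s n * (2 * Re (v $ s * cnj (w $ n))))"
    by (rule sum.cong[OF refl], rule sum.swap)
  also have "\<dots> = (\<Sum>s\<in>UNIV. \<Sum>n\<in>UNIV. (\<Sum>m\<in>UNIV. Im (u $ m) * ?T m s n) * (2 * Re (v $ s * cnj (w $ n))))"
    unfolding sum_distrib_right by (rule sum.swap)
  finally show "frechet_derivative (\<lambda>p. g p v w) (at z) u = g z (Gam ?x u v) w + g z v (Gam ?x u w)"
    unfolding frechet_derivative_g[OF z] by simp
qed

lemma christoffel_eq:
  assumes z: "z \<in> tube U"
  shows "christoffel g z = Gam (Im_vec z)"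
  unfolding christoffel_def
proof (rule the_equality)
  show "levi_civita_at g z (Gam (Im_vec z))" by (rule levi_civita_Gam[OF z])
  then show "\<Gamma> = Gam (Im_vec z)" if "levi_civita_at g z \<Gamma>" for \<Gamma>
    by (rule levi_civita_at_unique[OF that _ linear_g[OF z] g_sym[OF z] g_nondegenerate[OF z]])
qed

section \<open>Curvature and Ricci tensor of a tube metric\<close>

lemma has_derivative_Gam:
  assumes z: "z \<in> tube U"
  shows "((\<lambda>p. Gam (Im_vec p) v w) has_derivative (\<lambda>u. dGam (Im_vec z) u v w)) (at z)"
proof -
  have x: "Im_vec z \<in> U" using z by (simp add: tube_def)
  show ?thesis
    unfolding Gam_def dGam_def
    by (intro has_derivative_vec_lambda has_derivative_mult_right has_derivative_sum has_derivative_mult_left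
        has_derivative_of_real has_derivative_Im_vec_compose C_diff x)
qed

text \<open>Constant fields commute and have zero flat derivative, which leaves the derivative of
  \<open>Gam\<close> and its quadratic terms.\<close>

lemma curvature_const:
  assumes z: "z \<in> tube U"
  shows "curvature g (\<lambda>_. u) (\<lambda>_. v) (\<lambda>_. w) z = dGam (Im_vec z) u v w - dGam (Im_vec z) v u w
    + Gam (Im_vec z) u (Gam (Im_vec z) v w) - Gam (Im_vec z) v (Gam (Im_vec z) u w)"
proof -
  have nab: "nabla g (\<lambda>_. v) (\<lambda>_. w) p = Gam (Im_vec p) v w" if "p \<in> tube U" for p v w
    using that by (simp add: nabla_def christoffel_eq)
  have "((nabla g (\<lambda>_. v) (\<lambda>_. w)) has_derivative (\<lambda>u. dGam (Im_vec z) u v w)) (at z)" for v w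
    by (rule has_derivative_transform_within_open[OF has_derivative_Gam[OF z] open_tube[OF open_U] z])
      (simp add: nab)
  note d = fun_cong[OF frechet_derivative_at[OF this, symmetric]]
  have "nabla g (lie_bracket (\<lambda>_. u) (\<lambda>_. v)) (\<lambda>_. w) z = 0"
    using bilinear_lzero[OF bilinear_Gam] by (simp add: nabla_def lie_bracket_def christoffel_eq[OF z])
  moreover have "nabla g (\<lambda>_. u) (nabla g (\<lambda>_. v) (\<lambda>_. w)) z
      = dGam (Im_vec z) u v w + Gam (Im_vec z) u (Gam (Im_vec z) v w)" for u v
    unfolding nabla_def[of g "\<lambda>_. u"] using d nab[OF z] by (simp add: christoffel_eq[OF z])
  ultimately show ?thesis
    unfolding curvature_def by simp
qed

lemma dGam_scale: "dGam x u (c *s v) w = c *s dGam x u v w" "dGam x u v (c *s w) = c *s dGam x u v w"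
  by (simp_all add: dGam_def vec_eq_iff sum_distrib_left mult_ac)

lemma curv_coeff_eq:
  assumes z: "z \<in> tube U"
  shows "curv_coeff g r s m n z = complex_of_real (- 1/2 * pd n (C r m s) (Im_vec z))"
proof -
  let ?x = "Im_vec z"
  let ?R = "\<lambda>u v w. curvature g (\<lambda>_. u) (\<lambda>_. v) (\<lambda>_. w) z $ r"
  let ?e = "axis s (1::complex)"
  have 1: "cext (?R u v) (del_z s) = ?R u v ?e" for u v
    by (rule cext_del_z) (simp add: curvature_const[OF z] dGam_scale Gam_scale algebra_simps)
  have delta: "(\<Sum>i\<in>UNIV. c i * (axis k (1::complex)) $ i) = c k" for c and k :: 'n
    by (simp add: axis_def if_distrib[of "\<lambda>z. _ * z"] cong: if_cong)
  have delta': "(\<Sum>i\<in>UNIV. c i * (b * (axis k (1::complex)) $ i)) = c k * b" for b c and k :: 'n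
    using delta[of "\<lambda>i. c i * b" k] by (simp add: mult.assoc)
  have 2: "cext (\<lambda>v. ?R u v ?e) (del_zbar n) = - 1/2 * (\<Sum>m\<in>UNIV. complex_of_real (pd n (C r m s) ?x) * u $ m)" for u
  proof -
    \<comment> \<open>\<open>a\<close> collects the terms complex-linear in \<open>v\<close>, which
      vanish on the conjugate field. What survives is the term where \<open>dGam\<close> is
      differentiated along \<open>v\<close>; \<open>B k\<close> is its coefficient at
      \<open>Im (v $ k)\<close>.\<close>
    define a where "a v = (dGam ?x u v ?e + Gam ?x u (Gam ?x v ?e) - Gam ?x v (Gam ?x u ?e)) $ r" for v
    define B where "B k = \<i> * (\<Sum>m\<in>UNIV. complex_of_real (pd k (C r m s) ?x) * u $ m)" for k
    have "- dGam ?x v u ?e $ r = (\<Sum>k\<in>UNIV. complex_of_real (Im (v $ k)) * B k)" for v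
    proof -
      have "- dGam ?x v u ?e $ r = \<i> * (\<Sum>m\<in>UNIV. \<Sum>k\<in>UNIV. complex_of_real (Im (v $ k) * pd k (C r m s) ?x) * u $ m)"
        by (simp add: dGam_def delta' del: of_real_sum) (simp add: sum_distrib_right)
      also have "\<dots> = \<i> * (\<Sum>k\<in>UNIV. \<Sum>m\<in>UNIV. complex_of_real (Im (v $ k) * pd k (C r m s) ?x) * u $ m)"
        by (subst sum.swap) simp
      finally show ?thesis
        by (simp add: B_def sum_distrib_left mult_ac)
    qed
    then have "?R u v ?e = a v + (\<Sum>k\<in>UNIV. complex_of_real (Im (v $ k)) * B k)" for v
      unfolding curvature_const[OF z] a_def by (simp add: algebra_simps)
    moreover have "cext a (del_zbar n) = 0"
      by (rule cext_del_zbar) (simp add: a_def dGam_scale Gam_scale algebra_simps)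
    ultimately show ?thesis
      by (simp add: cext_add cext_Im_del_zbar) (simp add: B_def)
  qed
  have 3: "cext (\<lambda>u. - 1/2 * (\<Sum>m\<in>UNIV. complex_of_real (pd n (C r m s) ?x) * u $ m)) (del_z m)
      = - 1/2 * complex_of_real (pd n (C r m s) ?x)"
    by (subst cext_del_z) (simp add: sum_distrib_left mult_ac, simp only: delta)
  show ?thesis
    unfolding curv_coeff_def 1 2 3 by simp
qed

theorem Ricci_eq:
  assumes z: "z \<in> tube U"
  shows "Ricci g z $ \<mu> $ \<nu> = complex_of_real (- 1/2 * pd \<nu> (\<lambda>x. \<Sum>r\<in>UNIV. C r r \<mu> x) (Im_vec z))"
proof -
  have "Im_vec z \<in> U" using z by (simp add: tube_def)
  then show ?thesis
    by (simp add: Ricci_def curv_coeff_eq[OF z] pd_sum C_diff sum_divide_distrib sum_negf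
      flip: sum_divide_distrib)
qed

end

section \<open>The r-map metric\<close>

lemma matrix_mult_of_real:
  "(\<chi> i j. complex_of_real (A $ i $ j)) ** (\<chi> i j. complex_of_real (B $ i $ j))
    = (\<chi> i j. complex_of_real ((A ** B) $ i $ j))"
  by (simp add: matrix_matrix_mult_def vec_eq_iff)

text \<open>The trace of the product of \<open>A\<close> with the matrix of \<open>E\<close>, with
  the index order of Jacobi's formula \<open>pd_det\<close>.\<close>

definition contr :: "real^'n^'n \<Rightarrow> ('n \<Rightarrow> 'n \<Rightarrow> real) \<Rightarrow> real" where
  "contr A E = (\<Sum>i\<in>UNIV. \<Sum>j\<in>UNIV. A $ i $ j * E j i)"

lemma contr_linear:
  "contr A (\<lambda>i j. E i j + F i j) = contr A E + contr A F"
  "contr A (\<lambda>i j. E i j - F i j) = contr A E - contr A F"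
  "contr A (\<lambda>i j. c * E i j) = c * contr A E"
  "contr A (\<lambda>i j. E i j / c) = contr A E / c"
  by (simp_all add: contr_def sum.distrib sum_subtractf distrib_left right_diff_distrib
      sum_distrib_left sum_divide_distrib mult_ac)

lemma contr_linear_left:
  "contr (\<chi> i j. c * (a * A $ i $ j + b * B $ i $ j)) E = c * (a * contr A E + b * contr B E)"
  by (simp add: contr_def sum.distrib sum_distrib_left algebra_simps)

lemma contr_outer: "contr A (\<lambda>i j. a i * b j) = (\<Sum>j\<in>UNIV. a j * (\<Sum>i\<in>UNIV. b i * A $ i $ j))"
  unfolding contr_def by (subst sum.swap) (simp add: sum_distrib_left mult_ac)

section \<open>Homogeneity of \<open>h\<close> and of its Hessian determinant\<close>

locale r_map =
  fixes U :: "(real^'n) set" and h :: "real^'n \<Rightarrow> real" and D :: real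
  assumes U_open: "open U"
    and U_cone: "\<And>x t. x \<in> U \<Longrightarrow> t > 0 \<Longrightarrow> t *\<^sub>R x \<in> U"
    and h_smooth: "smooth_on h U"
    and h_pos: "\<And>x. x \<in> U \<Longrightarrow> h x > 0"
    and D_pos: "D > 0" and D_neq_1: "D \<noteq> 1"
    and h_hom: "\<And>x t. x \<in> U \<Longrightarrow> t > 0 \<Longrightarrow> h (t *\<^sub>R x) = t powr D * h x"
    and level: "riemannian_level_set U h"
begin

lemmas h_diff = smooth_on_differentiable[OF h_smooth]
lemmas dh_diff = smooth_on_differentiable[OF smooth_on_pd[OF h_smooth]]
lemmas ddh_diff = smooth_on_differentiable[OF smooth_on_pd[OF smooth_on_pd[OF h_smooth]]]
lemmas dddh_diff = smooth_on_differentiable[OF smooth_on_pd[OF smooth_on_pd[OF smooth_on_pd[OF h_smooth]]]]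

lemma h_homogeneous: "homogeneous_on U D h"
  using h_hom by (simp add: homogeneous_on_def)

lemma dh_homogeneous: "homogeneous_on U (D - 1) (pd i h)"
  by (rule pd_homogeneous_on[OF h_homogeneous U_open U_cone h_diff])

lemma ddh_homogeneous: "homogeneous_on U (D - 2) (pd i (pd j h))"
  using pd_homogeneous_on[OF dh_homogeneous U_open U_cone dh_diff] by simp

lemma euler_h: "x \<in> U \<Longrightarrow> (\<Sum>i\<in>UNIV. x $ i * pd i h x) = D * h x"
  by (rule euler_identity[OF h_homogeneous _ h_diff])

lemma euler_dh:
  assumes "x \<in> U"
  shows "(\<Sum>i\<in>UNIV. x $ i * pd i (pd j h) x) = (D - 1) * pd j h x"
    and "(\<Sum>i\<in>UNIV. x $ i * pd j (pd i h) x) = (D - 1) * pd j h x"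
  using euler_identity[OF dh_homogeneous assms dh_diff[OF assms]] pd_commute[OF h_smooth U_open assms, of j] by simp_all

lemma euler_ddh: "x \<in> U \<Longrightarrow> (\<Sum>i\<in>UNIV. x $ i * pd i (pd j (pd k h)) x) = (D - 2) * pd j (pd k h) x"
  by (rule euler_identity[OF ddh_homogeneous _ ddh_diff])

lemma hessian_nth: "hessian h x $ i $ j = pd i (pd j h) x"
  by (simp add: hessian_def)

text \<open>Second derivatives of \<open>h\<close> have degree \<open>D - 2\<close>, and the
  determinant takes one such factor from each row.\<close>

lemma hdet_homogeneous: "homogeneous_on U (real CARD('n) * (D - 2)) (hdet h)"
  unfolding homogeneous_on_def
proof (intro ballI allI impI)
  fix x and t :: real assume x: "x \<in> U" and t: "t > 0"
  have "hessian h (t *\<^sub>R x) = (\<chi> i. t powr (D - 2) *s hessian h x $ i)"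
    by (simp add: vec_eq_iff hessian_nth homogeneous_onD[OF ddh_homogeneous x t])
  then have "hdet h (t *\<^sub>R x) = (t powr (D - 2)) ^ CARD('n) * hdet h x"
    by (simp add: hdet_def det_rows_mul)
  also have "(t powr (D - 2)) ^ CARD('n) = t powr (real CARD('n) * (D - 2))"
    using t by (simp add: powr_realpow[symmetric] powr_powr mult.commute)
  finally show "hdet h (t *\<^sub>R x) = t powr (real CARD('n) * (D - 2)) * hdet h x" .
qed

lemma hdet_smooth: "smooth_on (hdet h) U"
  unfolding hdet_def[abs_def]
  by (rule smooth_on_det[OF U_open]) (simp add: hessian_nth smooth_on_pd h_smooth)

lemmas hdet_diff = smooth_on_differentiable[OF hdet_smooth]
lemmas dhdet_diff = smooth_on_differentiable[OF smooth_on_pd[OF hdet_smooth]]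

text \<open>A null vector of the Hessian at \<open>x\<close> lies in the kernel of \<open>dh\<close>, by Euler's identity
  \<open>x\<^sup>i h\<^sub>i\<^sub>j = (D - 1) h\<^sub>j\<close>, hence is tangent to the level set.\<close>

lemma hdet_nonzero:
  assumes x: "x \<in> U"
  shows "hdet h x \<noteq> 0"
proof
  assume 0: "hdet h x = 0"
  \<comment> \<open>Chosen so that \<open>h (t *\<^sub>R x) = 1\<close>: definiteness is given on
    the level set only, and homogeneity of \<open>hdet h\<close> carries the zero there.\<close>
  define t where "t = h x powr (- 1 / D)"
  have t: "t > 0" using h_pos[OF x] by (simp add: t_def)
  define y where "y = t *\<^sub>R x"
  have y: "y \<in> U" using U_cone[OF x t] by (simp add: y_def)
  have "t powr D = 1 / h x"
    unfolding t_def powr_powr using h_pos[OF x] D_pos by (simp add: powr_minus_divide)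
  then have "h y = 1"
    using h_hom[OF x t] h_pos[OF x] by (simp add: y_def)
  have "det (hessian h y) = 0"
    using homogeneous_onD[OF hdet_homogeneous x t] 0 by (simp add: y_def hdet_def)
  then obtain v where v: "v \<noteq> 0" "hessian h y *v v = 0"
    using invertible_det_nz[of "hessian h y"] invertible_left_inverse[of "hessian h y"]
      matrix_left_invertible_ker[of "hessian h y"] by blast
  have "0 = (\<Sum>i\<in>UNIV. y $ i * (hessian h y *v v) $ i)"
    by (simp add: v)
  also have "\<dots> = (\<Sum>j\<in>UNIV. (\<Sum>i\<in>UNIV. y $ i * pd i (pd j h) y) * v $ j)"
    unfolding matrix_vector_mult_def hessian_nth
    by (simp add: sum_distrib_left sum_distrib_right mult.assoc) (rule sum.swap)
  also have "\<dots> = (D - 1) * (\<Sum>j\<in>UNIV. v $ j * pd j h y)"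
    by (simp add: euler_dh(1)[OF y] sum_distrib_left mult_ac)
  finally have "(\<Sum>j\<in>UNIV. v $ j * pd j h y) = 0" using D_neq_1 by simp
  moreover have "frechet_derivative h (at y) v = (\<Sum>j\<in>UNIV. v $ j * pd j h y)"
    using fun_cong[OF frechet_derivative_at[OF has_derivative_pd[OF h_diff[OF y]], symmetric]] .
  ultimately have "- (v \<bullet> (hessian h y *v v)) > 0"
    using level y \<open>h y = 1\<close> v(1) unfolding riemannian_level_set_def by simp
  then show False by (simp add: v)
qed

section \<open>The inverse Hessian\<close>

abbreviation (input) "Hi x \<equiv> matrix_inv (hessian h x)"

lemma hessian_inv:
  assumes "x \<in> U"
  shows "hessian h x ** Hi x = mat 1" "Hi x ** hessian h x = mat 1"
  using matrix_inv_works[of "hessian h x"] hdet_nonzero[OF assms] by (auto simp: hdet_def)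

lemma hessian_inv_nth:
  assumes "x \<in> U"
  shows "(\<Sum>k\<in>UNIV. pd i (pd k h) x * Hi x $ k $ j) = (if i = j then 1 else 0)"
    and "(\<Sum>k\<in>UNIV. Hi x $ i $ k * pd k (pd j h) x) = (if i = j then 1 else 0)"
proof -
  have "(hessian h x ** Hi x) $ i $ j = (if i = j then 1 else 0)"
    "(Hi x ** hessian h x) $ i $ j = (if i = j then 1 else 0)"
    using hessian_inv[OF assms] by (simp_all add: mat_def)
  then show "(\<Sum>k\<in>UNIV. pd i (pd k h) x * Hi x $ k $ j) = (if i = j then 1 else 0)"
    "(\<Sum>k\<in>UNIV. Hi x $ i $ k * pd k (pd j h) x) = (if i = j then 1 else 0)"
    by (simp_all add: matrix_matrix_mult_def hessian_nth)
qed

text \<open>Euler's identity for \<open>dh\<close> multiplied by the inverse Hessian;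
  \<open>D \<noteq> 1\<close> permits the division.\<close>

lemma dh_hessian_inv:
  assumes x: "x \<in> U"
  shows "(\<Sum>k\<in>UNIV. pd k h x * Hi x $ k $ j) = x $ j / (D - 1)"
    and "(\<Sum>k\<in>UNIV. pd k h x * Hi x $ j $ k) = x $ j / (D - 1)"
proof -
  have "(\<Sum>k\<in>UNIV. ((D - 1) * pd k h x) * Hi x $ k $ j) = (\<Sum>i\<in>UNIV. x $ i * (\<Sum>k\<in>UNIV. pd i (pd k h) x * Hi x $ k $ j))"
    unfolding euler_dh(1)[OF x, symmetric] sum_distrib_left sum_distrib_right mult.assoc
    by (rule sum.swap)
  also have "\<dots> = x $ j" by (simp add: hessian_inv_nth(1)[OF x] if_distrib[of "\<lambda>z. _ * z"] cong: if_cong)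
  finally have "(D - 1) * (\<Sum>k\<in>UNIV. pd k h x * Hi x $ k $ j) = x $ j"
    by (simp only: mult.assoc flip: sum_distrib_left)
  then show "(\<Sum>k\<in>UNIV. pd k h x * Hi x $ k $ j) = x $ j / (D - 1)"
    using D_neq_1 by (simp add: eq_divide_eq mult.commute)
  have "(\<Sum>k\<in>UNIV. ((D - 1) * pd k h x) * Hi x $ j $ k) = (\<Sum>i\<in>UNIV. x $ i * (\<Sum>k\<in>UNIV. Hi x $ j $ k * pd k (pd i h) x))"
    unfolding euler_dh(2)[OF x, symmetric] sum_distrib_left sum_distrib_right
    by (subst sum.swap) (simp only: mult_ac)
  also have "\<dots> = x $ j" by (simp add: hessian_inv_nth(2)[OF x] if_distrib[of "\<lambda>z. _ * z"] cong: if_cong)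
  finally have "(D - 1) * (\<Sum>k\<in>UNIV. pd k h x * Hi x $ j $ k) = x $ j"
    by (simp only: mult.assoc flip: sum_distrib_left)
  then show "(\<Sum>k\<in>UNIV. pd k h x * Hi x $ j $ k) = x $ j / (D - 1)"
    using D_neq_1 by (simp add: eq_divide_eq mult.commute)
qed

section \<open>The matrix of the metric, its inverse and its derivatives\<close>

definition G :: "real^'n \<Rightarrow> real^'n^'n" where
  "G x = (\<chi> i j. 1/4 * (pd i h x * pd j h x / (h x)\<^sup>2 - pd i (pd j h) x / h x))"

definition XX :: "real^'n \<Rightarrow> real^'n^'n" where
  "XX x = (\<chi> i j. x $ i * x $ j)"

text \<open>The Sherman-Morrison formula: \<open>G\<close> is a rank-one perturbation of a multiple
  of the Hessian by dh, and the inverse Hessian sends dh to \<open>x / (D - 1)\<close>, whence the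
  correction by \<open>XX\<close>.\<close>

definition Gi :: "real^'n \<Rightarrow> real^'n^'n" where
  "Gi x = (\<chi> i j. 4 * (- h x * Hi x $ i $ j + 1 / (D - 1) * XX x $ i $ j))"

lemma G_Gi:
  assumes x: "x \<in> U"
  shows "G x ** Gi x = mat 1"
proof -
  have "(\<Sum>k\<in>UNIV. G x $ i $ k * Gi x $ k $ j) = (if i = j then 1 else 0)" for i j
  proof -
    \<comment> \<open>Multiplying out gives four sums, each known from an Euler identity or from the
      inverse Hessian.\<close>
    have "(\<Sum>k\<in>UNIV. G x $ i $ k * Gi x $ k $ j) =
      - (pd i h x / h x) * (\<Sum>k\<in>UNIV. pd k h x * Hi x $ k $ j)
      + pd i h x / ((h x)\<^sup>2 * (D - 1)) * x $ j * (\<Sum>k\<in>UNIV. x $ k * pd k h x)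
      + (\<Sum>k\<in>UNIV. pd i (pd k h) x * Hi x $ k $ j)
      - 1 / (h x * (D - 1)) * x $ j * (\<Sum>k\<in>UNIV. x $ k * pd i (pd k h) x)"
      unfolding sum_distrib_left sum.distrib[symmetric] sum_subtractf[symmetric]
    proof (intro sum.cong refl)
      fix k
      have "(1/4 * (a * b / c\<^sup>2 - q / c)) * (4 * (- c * r + 1 / e * (y * w)))
          = - (a / c) * (b * r) + a / (c\<^sup>2 * e) * w * (y * b) + q * r - 1 / (c * e) * w * (y * q)"
        if "c \<noteq> 0" "e \<noteq> 0" for a b c e q r y w :: real
        using that by (simp add: field_simps power2_eq_square)
      from this[of "h x" "D - 1"] show "G x $ i $ k * Gi x $ k $ j =
        - (pd i h x / h x) * (pd k h x * Hi x $ k $ j)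
        + pd i h x / ((h x)\<^sup>2 * (D - 1)) * x $ j * (x $ k * pd k h x)
        + pd i (pd k h) x * Hi x $ k $ j - 1 / (h x * (D - 1)) * x $ j * (x $ k * pd i (pd k h) x)"
        using h_pos[OF x] D_neq_1 by (simp add: G_def Gi_def XX_def)
    qed
    also have "\<dots> = - (pd i h x / h x) * (x $ j / (D - 1)) + pd i h x / ((h x)\<^sup>2 * (D - 1)) * x $ j * (D * h x)
      + (if i = j then 1 else 0) - 1 / (h x * (D - 1)) * x $ j * ((D - 1) * pd i h x)"
      by (simp only: dh_hessian_inv(1)[OF x] euler_h[OF x] hessian_inv_nth(1)[OF x] euler_dh(2)[OF x])
    also have "\<dots> = (if i = j then 1 else 0)"
    proof -
      \<comment> \<open>\<open>c\<close> is \<open>h x\<close>, and \<open>e\<close> stands for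
        \<open>D - 1\<close>, so \<open>e + 1\<close> is \<open>D\<close>.\<close>
      have "- (p / c) * (a / e) + p / (c\<^sup>2 * e) * a * ((e + 1) * c) - 1 / (c * e) * a * (e * p) = 0"
        if "c \<noteq> 0" "e \<noteq> 0" for p c a e :: real
        using that by (simp add: field_simps power2_eq_square)
      from this[of "h x" "D - 1" "pd i h x" "x $ j"] show ?thesis
        using h_pos[OF x] D_neq_1 by simp
    qed
    finally show ?thesis .
  qed
  then show ?thesis
    by (simp add: vec_eq_iff matrix_matrix_mult_def mat_def)
qed

lemma matrix_inv_G: "x \<in> U \<Longrightarrow> matrix_inv (G x) = Gi x"
  by (rule matrix_inv_eqI[OF G_Gi])

lemma ddln_h:
  assumes x: "x \<in> U"
  shows "pd i (pd j (\<lambda>x. - ln (h x))) x = 4 * G x $ i $ j"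
    and "pd j (\<lambda>x. - ln (h x)) differentiable (at x)"
    and "(\<lambda>x. - ln (h x)) differentiable (at x)"
proof -
  have nz: "h x \<noteq> 0" if "x \<in> U" for x using h_pos[OF that] by simp
  have neg: "pd j (\<lambda>x. - f x) x = - pd j f x" if "f differentiable (at x)" for f x and j :: 'n
    using pd_cmult[OF that, of j "-1"] by simp
  have d: "(\<lambda>x. ln (h x)) differentiable (at x)" if "x \<in> U" for x
    by (rule pd_ln(2)[OF h_diff nz]) (rule that)+
  then show "(\<lambda>x. - ln (h x)) differentiable (at x)" using x by simp
  have eq: "- pd j (\<lambda>x. ln (h x)) y = pd j (\<lambda>x. - ln (h x)) y" if "y \<in> U" for y
    by (rule neg[symmetric, OF d[OF that]])
  note dd = pd_pd_ln[OF U_open x h_smooth nz]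
  have d2: "(\<lambda>y. - pd j (\<lambda>x. ln (h x)) y) differentiable (at x)"
    using dd(2) by simp
  show "pd j (\<lambda>x. - ln (h x)) differentiable (at x)"
    by (rule differentiable_cong_open[OF U_open x eq d2])
  show "pd i (pd j (\<lambda>x. - ln (h x))) x = 4 * G x $ i $ j"
    using pd_cong_open[OF U_open x eq d2, of i] neg[OF dd(2)] dd(1)
    by (simp add: G_def)
qed

lemma gmat_eq:
  assumes "z \<in> tube U"
  shows "gmat h z = (\<chi> i j. complex_of_real (G (Im_vec z) $ i $ j))"
proof -
  have "Im_vec z \<in> U" using assms by (simp add: tube_def)
  then show ?thesis
    using pdz_pdzbar_hessian[OF U_open assms ddln_h(3) ddln_h(2)]
    by (simp add: gmat_def kpot_def[abs_def] vec_eq_iff ddln_h(1))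
qed

lemma G_symmetric: "x \<in> U \<Longrightarrow> G x $ i $ j = G x $ j $ i"
  using pd_commute[OF h_smooth U_open] by (simp add: G_def mult.commute)

text \<open>Since \<open>G\<close> is symmetric, both halves of the symmetric product contribute
  equally; hence the factor 2.\<close>

lemma gM_eq:
  assumes z: "z \<in> tube U"
  shows "gM h z v w = (\<Sum>\<mu>\<in>UNIV. \<Sum>\<nu>\<in>UNIV. G (Im_vec z) $ \<mu> $ \<nu> * (2 * Re (v $ \<mu> * cnj (w $ \<nu>))))"
proof -
  let ?G = "G (Im_vec z)"
  have x: "Im_vec z \<in> U" using z by (simp add: tube_def)
  have "gM h z v w = (\<Sum>\<mu>\<in>UNIV. \<Sum>\<nu>\<in>UNIV. ?G $ \<mu> $ \<nu> * Re (v $ \<mu> * cnj (w $ \<nu>)))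
      + (\<Sum>\<mu>\<in>UNIV. \<Sum>\<nu>\<in>UNIV. ?G $ \<mu> $ \<nu> * Re (w $ \<mu> * cnj (v $ \<nu>)))"
    unfolding gM_def gmat_eq[OF z] sum.distrib[symmetric] Re_sum
    by (intro sum.cong refl) (simp add: algebra_simps)
  also have "(\<Sum>\<mu>\<in>UNIV. \<Sum>\<nu>\<in>UNIV. ?G $ \<mu> $ \<nu> * Re (w $ \<mu> * cnj (v $ \<nu>)))
      = (\<Sum>\<nu>\<in>UNIV. \<Sum>\<mu>\<in>UNIV. ?G $ \<mu> $ \<nu> * Re (w $ \<mu> * cnj (v $ \<nu>)))"
    by (rule sum.swap)
  also have "\<dots> = (\<Sum>\<mu>\<in>UNIV. \<Sum>\<nu>\<in>UNIV. ?G $ \<mu> $ \<nu> * Re (v $ \<mu> * cnj (w $ \<nu>)))"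
    by (intro sum.cong refl) (subst G_symmetric[OF x], simp add: mult.commute)
  finally show ?thesis by (simp add: sum_distrib_left mult.left_commute[of 2])
qed

text \<open>The first derivative of \<open>G\<close> written out, so that contractions can be
  evaluated term by term.\<close>

definition dG :: "'n \<Rightarrow> 'n \<Rightarrow> 'n \<Rightarrow> real^'n \<Rightarrow> real" where
  "dG k i j x = 1/4 * ((pd k (pd i h) x * pd j h x + pd i h x * pd k (pd j h) x) / (h x)\<^sup>2
     - 2 * pd k h x / (h x) ^ 3 * (pd i h x * pd j h x)
     - (pd k (pd i (pd j h)) x / h x - pd k h x / (h x)\<^sup>2 * pd i (pd j h) x))"

lemma pd_G:
  assumes x: "x \<in> U"
  shows "(\<lambda>x. G x $ i $ j) differentiable (at x)" "pd k (\<lambda>x. G x $ i $ j) x = dG k i j x"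
proof -
  note d = h_diff[OF x] dh_diff[OF x] ddh_diff[OF x]
  have nz: "h x \<noteq> 0" "h x * h x \<noteq> 0" using h_pos[OF x] by auto
  have eq: "(\<lambda>x. G x $ i $ j) = (\<lambda>x. 1/4 * (pd i h x * pd j h x / (h x * h x) - pd i (pd j h) x / h x))"
    by (simp add: G_def power2_eq_square)
  have a: "(\<lambda>x. pd i h x * pd j h x) differentiable (at x)" "(\<lambda>x. h x * h x) differentiable (at x)"
    using d by (auto intro: differentiable_mult)
  have b: "(\<lambda>x. pd i h x * pd j h x / (h x * h x)) differentiable (at x)"
    "(\<lambda>x. pd i (pd j h) x / h x) differentiable (at x)"
    using a d nz by (auto intro: differentiable_divide)
  then have c: "(\<lambda>x. pd i h x * pd j h x / (h x * h x) - pd i (pd j h) x / h x) differentiable (at x)"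
    by (rule differentiable_diff)
  then show "(\<lambda>x. G x $ i $ j) differentiable (at x)"
    unfolding eq by simp
  have "pd k (\<lambda>x. G x $ i $ j) x = 1/4 * ((pd k (pd i h) x * pd j h x + pd i h x * pd k (pd j h) x) / (h x * h x)
     - pd i h x * pd j h x * (pd k h x * h x + h x * pd k h x) / (h x * h x)\<^sup>2
     - (pd k (pd i (pd j h)) x / h x - pd i (pd j h) x * pd k h x / (h x)\<^sup>2))"
    unfolding eq
    by (simp only: pd_cmult[OF c] pd_diff[OF b] pd_divide[OF a nz(2)] pd_divide[OF d(3) d(1) nz(1)]
        pd_mult[OF d(2) d(2)] pd_mult[OF d(1) d(1)])
  also have "\<dots> = dG k i j x"
    unfolding dG_def using nz by (simp add: field_simps power2_eq_square power3_eq_cube)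
  finally show "pd k (\<lambda>x. G x $ i $ j) x = dG k i j x" .
qed

lemma dG_differentiable: "x \<in> U \<Longrightarrow> pd k (\<lambda>x. G x $ i $ j) differentiable (at x)"
proof (rule differentiable_cong_open[OF U_open, of _ "dG k i j"])
  assume x: "x \<in> U"
  note d = h_diff[OF x] dh_diff[OF x] ddh_diff[OF x] dddh_diff[OF x]
  have "h x \<noteq> 0" using h_pos[OF x] by auto
  then show "dG k i j differentiable (at x)"
    unfolding dG_def[abs_def]
    by (intro differentiable_mult differentiable_diff differentiable_add differentiable_divide
        differentiable_power differentiable_const d) auto
qed (simp_all add: pd_G(2))

text \<open>Exchanging \<open>k\<close> and \<open>i\<close> interchanges the terms h_i h_kj and h_k
  h_ij; all others are symmetric because partial derivatives commute.\<close>

lemma dG_sym: "x \<in> U \<Longrightarrow> dG k i j x = dG i k j x"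
proof -
  assume x: "x \<in> U"
  note c = pd_commute[OF h_smooth U_open x, of k i] pd_commute[OF smooth_on_pd[OF h_smooth] U_open x, of k i]
  show ?thesis
    unfolding dG_def c by (simp add: algebra_simps add_divide_distrib)
qed

sublocale tube_metric U G "gM h"
proof
  show "open U" by (rule U_open)
  fix x i j k assume x: "x \<in> U"
  show "G x $ i $ j = G x $ j $ i" by (rule G_symmetric[OF x])
  show "det (G x) \<noteq> 0"
    using G_Gi[OF x] invertible_right_inverse[of "G x"] invertible_det_nz[of "G x"] by blast
  show "(\<lambda>x. G x $ i $ j) differentiable (at x)" by (rule pd_G(1)[OF x])
  show "pd k (\<lambda>x. G x $ i $ j) differentiable (at x)" by (rule dG_differentiable[OF x])
  show "pd k (\<lambda>x. G x $ i $ j) x = pd i (\<lambda>x. G x $ k $ j) x"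
    unfolding pd_G(2)[OF x] by (rule dG_sym[OF x])
qed (rule gM_eq)

section \<open>The trace of the connection as a logarithmic derivative\<close>

text \<open>The right-hand side is the derivative of log (d / h^m). The two summands of
  \<open>Gi\<close> are contracted separately with each term of \<open>dG\<close>: Jacobi's formula
  yields the part with \<open>hdet h\<close>, and Euler's identities the rest.\<close>

lemma contr_dG:
  assumes x: "x \<in> U"
  shows "contr (Gi x) (\<lambda>i j. dG k i j x) = pd k (hdet h) x / hdet h x - real CARD('n) * pd k h x / h x"
proof -
  let ?hk = "pd k h x"
  have e: "D - 1 \<noteq> 0" and h: "h x > 0" using D_neq_1 h_pos[OF x] by auto
  have Q1: "contr (Hi x) (\<lambda>i j. pd k (pd i h) x * pd j h x) = ?hk"
  proof -
    have "contr (Hi x) (\<lambda>i j. pd k (pd i h) x * pd j h x) = (\<Sum>j\<in>UNIV. x $ j * pd k (pd j h) x) / (D - 1)"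
      unfolding contr_outer dh_hessian_inv(1)[OF x] by (simp add: sum_divide_distrib mult.commute)
    then show ?thesis using e by (simp add: euler_dh(2)[OF x])
  qed
  have Q2: "contr (Hi x) (\<lambda>i j. pd i h x * pd k (pd j h) x) = ?hk"
  proof -
    have "contr (Hi x) (\<lambda>i j. pd i h x * pd k (pd j h) x)
        = (\<Sum>i\<in>UNIV. pd k (pd i h) x * (\<Sum>j\<in>UNIV. pd j h x * Hi x $ i $ j))"
      by (simp add: contr_def sum_distrib_left mult_ac)
    also have "\<dots> = (\<Sum>j\<in>UNIV. x $ j * pd k (pd j h) x) / (D - 1)"
      unfolding dh_hessian_inv(2)[OF x] by (simp add: sum_divide_distrib mult.commute)
    finally show ?thesis using e by (simp add: euler_dh(2)[OF x])
  qed
  have Q3: "contr (Hi x) (\<lambda>i j. pd i h x * pd j h x) = D * h x / (D - 1)"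
    unfolding contr_outer dh_hessian_inv(1)[OF x]
    using euler_h[OF x] by (simp add: sum_divide_distrib[symmetric] mult.commute)
  have Q4: "contr (Hi x) (\<lambda>i j. pd i (pd j h) x) = real CARD('n)"
    by (simp add: contr_def hessian_inv_nth(2)[OF x])
  have Q5: "contr (Hi x) (\<lambda>i j. pd k (pd i (pd j h)) x) = pd k (hdet h) x / hdet h x"
    using pd_det[of "hessian h" x "Hi x" k] ddh_diff[OF x] hessian_inv(2)[OF x] hdet_nonzero[OF x]
    by (simp add: hessian_nth contr_def hdet_def[abs_def])
  have XX: "contr (XX x) E = (\<Sum>j\<in>UNIV. x $ j * (\<Sum>i\<in>UNIV. x $ i * E i j))" for E
    by (simp add: contr_def XX_def sum_distrib_left mult_ac)
  have X_outer: "contr (XX x) (\<lambda>i j. a i * b j) = (\<Sum>i\<in>UNIV. x $ i * a i) * (\<Sum>i\<in>UNIV. x $ i * b i)" for a b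
    unfolding XX sum_product by (subst sum.swap) (simp add: sum_distrib_left mult_ac)
  have X4: "contr (XX x) (\<lambda>i j. pd i (pd j h) x) = (D - 1) * (D * h x)"
    unfolding XX euler_dh(1)[OF x] by (simp add: euler_h[OF x, symmetric] sum_distrib_left mult_ac)
  \<comment> \<open>Commuting \<open>k\<close> past \<open>i\<close> brings the contracted
    derivative outermost, where \<open>euler_ddh\<close> applies.\<close>
  have X5: "contr (XX x) (\<lambda>i j. pd k (pd i (pd j h)) x) = (D - 2) * ((D - 1) * ?hk)"
  proof -
    have "contr (XX x) (\<lambda>i j. pd k (pd i (pd j h)) x) = (\<Sum>j\<in>UNIV. x $ j * ((D - 2) * pd k (pd j h) x))"
      unfolding XX euler_ddh[OF x, symmetric]
      by (simp add: pd_commute[OF smooth_on_pd[OF h_smooth] U_open x, of k])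
    then show ?thesis by (simp add: euler_dh(2)[OF x, symmetric] sum_distrib_left mult_ac)
  qed
  have Q: "contr (Hi x) (\<lambda>i j. dG k i j x) = 1/4 * ((?hk + ?hk) / (h x)\<^sup>2
    - 2 * ?hk / (h x) ^ 3 * (D * h x / (D - 1)) - (pd k (hdet h) x / hdet h x / h x - ?hk / (h x)\<^sup>2 * real CARD('n)))"
    unfolding dG_def contr_linear Q1 Q2 Q3 Q4 Q5 ..
  have X: "contr (XX x) (\<lambda>i j. dG k i j x) = 1/4 * (((D - 1) * ?hk * (D * h x) + (D * h x) * ((D - 1) * ?hk)) / (h x)\<^sup>2
    - 2 * ?hk / (h x) ^ 3 * ((D * h x) * (D * h x)) - ((D - 2) * ((D - 1) * ?hk) / h x - ?hk / (h x)\<^sup>2 * ((D - 1) * (D * h x))))"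
    unfolding dG_def contr_linear X_outer X4 X5 euler_h[OF x] euler_dh(2)[OF x] ..
  \<comment> \<open>Here \<open>c = h x\<close>, \<open>e = D - 1\<close>, \<open>p\<close> is
    \<open>?hk\<close>, \<open>q\<close> the logarithmic derivative of \<open>hdet h\<close> and
    \<open>n\<close> the dimension. The rank-one correction cancels the leftover
    \<open>2 * p / (c * e)\<close>.\<close>
  have alg: "4 * (- c * (1/4 * ((p + p) / c\<^sup>2 - 2 * p / c ^ 3 * ((e + 1) * c / e) - (q / c - p / c\<^sup>2 * n)))
      + 1 / e * (1/4 * ((e * p * ((e + 1) * c) + ((e + 1) * c) * (e * p)) / c\<^sup>2
    - 2 * p / c ^ 3 * (((e + 1) * c) * ((e + 1) * c)) - ((e - 1) * (e * p) / c - p / c\<^sup>2 * (e * ((e + 1) * c))))))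
    = q - n * p / c" if "c > 0" "e \<noteq> 0" for c e p q n :: real
    using that by (simp add: divide_simps power2_eq_square power3_eq_cube) (simp add: algebra_simps)
  show ?thesis
    unfolding Gi_def contr_linear_left Q X
    using alg[OF h e, of ?hk "pd k (hdet h) x / hdet h x" "real CARD('n)"] by simp
qed

definition F :: "real^'n \<Rightarrow> real" where
  "F x = ln (hdet h x) - real CARD('n) * ln (h x)"

lemma F_eq:
  assumes "x \<in> U"
  shows "ln (\<bar>hdet h x\<bar> / h x ^ CARD('n)) = F x"
  using hdet_nonzero[OF assms] h_pos[OF assms] by (simp add: F_def ln_div ln_realpow ln_abs)

text \<open>In the second derivative, the term in log h reappears as a multiple of \<open>G\<close>,
  which is a quarter of the Hessian of -log h.\<close>

lemma pd_F:
  assumes x: "x \<in> U"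
  shows "F differentiable (at x)"
    and "pd k F x = pd k (hdet h) x / hdet h x - real CARD('n) * pd k h x / h x"
    and "pd k F differentiable (at x)"
    and "pd i (pd k F) x = (pd i (pd k (hdet h)) x / hdet h x
      - pd i (hdet h) x * pd k (hdet h) x / (hdet h x)\<^sup>2) + 4 * real CARD('n) * G x $ i $ k"
proof -
  have nz: "h y \<noteq> 0" if "y \<in> U" for y using h_pos[OF that] by simp
  have d1: "(\<lambda>x. ln (hdet h x)) differentiable (at y)"
    "(\<lambda>x. real CARD('n) * ln (h x)) differentiable (at y)" "(\<lambda>x. ln (h x)) differentiable (at y)" if "y \<in> U" for y
    using pd_ln(2)[OF hdet_diff[OF that] hdet_nonzero[OF that]] pd_ln(2)[OF h_diff[OF that] nz[OF that]]
    by auto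
  have F1: "F differentiable (at y)" if "y \<in> U" for y
    unfolding F_def[abs_def] using d1[OF that] by (intro differentiable_diff)
  show "F differentiable (at x)" by (rule F1[OF x])
  have eq: "pd k (\<lambda>x. ln (hdet h x)) y - real CARD('n) * pd k (\<lambda>x. ln (h x)) y = pd k F y" if "y \<in> U" for y
    unfolding F_def[abs_def] by (simp add: pd_diff[OF d1(1,2)[OF that]] pd_cmult[OF d1(3)[OF that]])
  show "pd k F x = pd k (hdet h) x / hdet h x - real CARD('n) * pd k h x / h x"
    unfolding eq[OF x, symmetric]
    by (simp add: pd_ln(1)[OF hdet_diff[OF x] hdet_nonzero[OF x]] pd_ln(1)[OF h_diff[OF x] nz[OF x]])
  note dd = pd_pd_ln[OF U_open x hdet_smooth hdet_nonzero] pd_pd_ln[OF U_open x h_smooth nz]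
  have d2: "(\<lambda>y. real CARD('n) * pd k (\<lambda>x. ln (h x)) y) differentiable (at x)"
    using dd(4) by simp
  have d3: "(\<lambda>y. pd k (\<lambda>x. ln (hdet h x)) y - real CARD('n) * pd k (\<lambda>x. ln (h x)) y) differentiable (at x)"
    using dd(2) d2 by (rule differentiable_diff)
  show "pd k F differentiable (at x)"
    by (rule differentiable_cong_open[OF U_open x eq d3])
  have "pd i (pd k F) x = pd i (pd k (\<lambda>x. ln (hdet h x))) x - real CARD('n) * pd i (pd k (\<lambda>x. ln (h x))) x"
    using pd_cong_open[OF U_open x eq d3, of i] by (simp add: pd_diff[OF dd(2) d2] pd_cmult[OF dd(4)])
  also have "\<dots> = (pd i (pd k (hdet h)) x / hdet h x
      - pd i (hdet h) x * pd k (hdet h) x / (hdet h x)\<^sup>2) + 4 * real CARD('n) * G x $ i $ k"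
    by (simp add: dd(1,3) G_def algebra_simps)
  finally show "pd i (pd k F) x = (pd i (pd k (hdet h)) x / hdet h x
      - pd i (hdet h) x * pd k (hdet h) x / (hdet h x)\<^sup>2) + 4 * real CARD('n) * G x $ i $ k" .
qed

section \<open>Ricci tensor and scalar curvature of the r-map metric\<close>

text \<open>By \<open>C_sym\<close> the trace of \<open>C\<close> is half the contraction of
  \<open>Gi\<close> with \<open>dG\<close>, hence half the gradient of \<open>F\<close>;
  \<open>Ricci_eq\<close> differentiates it once more.\<close>

lemma Ric_eq:
  assumes z: "z \<in> tube U"
  shows "Ric h z $ \<mu> $ \<nu> = complex_of_real (- 1/4 * pd \<mu> (pd \<nu> F) (Im_vec z))"
proof -
  let ?x = "Im_vec z"
  have x: "?x \<in> U" using z by (simp add: tube_def)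
  have C: "(\<Sum>r\<in>UNIV. C r r \<mu> y) = 1/2 * pd \<mu> F y" if y: "y \<in> U" for y
  proof -
    have "(\<Sum>r\<in>UNIV. C r r \<mu> y) = 1/2 * contr (Gi y) (\<lambda>i j. dG \<mu> i j y)"
      unfolding C_sym[OF y, of _ _ \<mu>] unfolding C_def
      by (simp add: matrix_inv_G[OF y] pd_G(2)[OF y] contr_def sum_divide_distrib)
    then show ?thesis by (simp add: contr_dG[OF y] pd_F(2)[OF y])
  qed
  have d: "(\<lambda>y. \<Sum>r\<in>UNIV. C r r \<mu> y) differentiable (at ?x)"
    by (intro differentiable_sum ballI C_diff x) auto
  have "pd \<nu> (\<lambda>y. \<Sum>r\<in>UNIV. C r r \<mu> y) ?x = pd \<nu> (\<lambda>y. 1/2 * pd \<mu> F y) ?x"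
    by (rule pd_cong_open[OF U_open x C d])
  also have "\<dots> = 1/2 * pd \<nu> (pd \<mu> F) ?x"
    by (rule pd_cmult[OF pd_F(3)[OF x]])
  \<comment> \<open>Symmetry is read off the explicit second derivative of \<open>F\<close>,
    reducing it to \<open>hdet h\<close> and \<open>G\<close>.\<close>
  also have "pd \<nu> (pd \<mu> F) ?x = pd \<mu> (pd \<nu> F) ?x"
    by (simp add: pd_F(4)[OF x] pd_commute[OF hdet_smooth U_open x, of \<nu>] G_symmetric[OF x, of \<nu>] mult.commute)
  finally have pd_C: "pd \<nu> (\<lambda>y. \<Sum>r\<in>UNIV. C r r \<mu> y) ?x = 1/2 * pd \<mu> (pd \<nu> F) ?x" .
  show ?thesis
    unfolding Ric_def Ricci_eq[OF z] pd_C by simp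
qed

lemma Ric_formula:
  assumes z: "z \<in> tube U"
  shows "Ric h z $ \<mu> $ \<nu> = - pdz \<mu> (pdzbar \<nu> (\<lambda>p. complex_of_real
     (ln (\<bar>hdet h (Im_vec p)\<bar> / h (Im_vec p) ^ CARD('n))))) z"
proof -
  have x: "Im_vec z \<in> U" using z by (simp add: tube_def)
  let ?L = "\<lambda>x. ln (\<bar>hdet h x\<bar> / h x ^ CARD('n))"
  have L1: "?L differentiable (at y)" "pd k F y = pd k ?L y" if "y \<in> U" for y k
    using differentiable_cong_open[OF U_open that F_eq[symmetric] pd_F(1)[OF that]]
      pd_cong_open[OF U_open that F_eq[symmetric] pd_F(1)[OF that]] by auto
  have L2: "pd \<nu> ?L differentiable (at y)" "pd \<mu> (pd \<nu> F) y = pd \<mu> (pd \<nu> ?L) y" if "y \<in> U" for y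
    using differentiable_cong_open[OF U_open that L1(2) pd_F(3)[OF that]]
      pd_cong_open[OF U_open that L1(2) pd_F(3)[OF that]] by auto
  have "pdz \<mu> (pdzbar \<nu> (\<lambda>p. complex_of_real (?L (Im_vec p)))) z
      = complex_of_real (1/4 * pd \<mu> (pd \<nu> ?L) (Im_vec z))"
    by (rule pdz_pdzbar_hessian[OF U_open z L1(1) L2(1)])
  then show ?thesis
    unfolding Ric_eq[OF z] L2(2)[OF x] by simp
qed

text \<open>Contracting \<open>Ric\<close> with \<open>Gi\<close> splits in three: the
  \<open>G\<close> part of the Hessian of \<open>F\<close> is a trace of the identity and gives
  -m^2, the inverse Hessian gives the terms in d, and \<open>XX\<close> gives the term linear in
  m.\<close>

lemma scal_formula:
  assumes z: "z \<in> tube U"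
  defines "x \<equiv> Im_vec z" and "d \<equiv> hdet h"
  shows "scal h z = complex_of_real (- (real CARD('n))\<^sup>2 + (D - 2) / (D - 1) * real CARD('n)
    - h x / d x * up_trace h d x + h x / (d x)\<^sup>2 * up_square h d x)"
proof -
  have x: "x \<in> U" using z by (simp add: tube_def x_def)
  have d0: "d x \<noteq> 0" using hdet_nonzero[OF x] by (simp add: d_def)
  let ?N = "real CARD('n) * (D - 2)"
  let ?P = "\<lambda>i j. pd i (pd j d) x / d x - pd i d x * pd j d x / (d x)\<^sup>2"
  have inv: "matrix_inv (gmat h z) = (\<chi> i j. complex_of_real (Gi x $ i $ j))"
    unfolding gmat_eq[OF z]
    by (rule matrix_inv_eqI) (simp add: matrix_mult_of_real G_Gi[OF x] x_def[symmetric] mat_def vec_eq_iff)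
  have comm: "pd i (pd j d) x = pd j (pd i d) x" for i j
    unfolding d_def by (rule pd_commute[OF hdet_smooth U_open x])
  have "scal h z = complex_of_real (contr (Gi x) (\<lambda>i j. - 1/4 * pd i (pd j F) x))"
    unfolding scal_def inv Ric_eq[OF z] contr_def
    by (subst sum.swap) (simp add: x_def)
  also have "contr (Gi x) (\<lambda>i j. - 1/4 * pd i (pd j F) x)
    = - 1/4 * (contr (Gi x) ?P + 4 * real CARD('n) * contr (Gi x) (\<lambda>i j. G x $ i $ j))"
    unfolding contr_linear[symmetric] pd_F(4)[OF x] by (simp add: d_def)
  also have "contr (Gi x) (\<lambda>i j. G x $ i $ j) = real CARD('n)"
  proof -
    have "Gi x ** G x = mat 1" using G_Gi[OF x] matrix_left_right_inverse by blast
    then have "(Gi x ** G x) $ i $ i = 1" for i by (simp add: mat_def)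
    then show ?thesis by (simp add: contr_def matrix_matrix_mult_def)
  qed
  also have "contr (Gi x) ?P = 4 * (- h x * contr (Hi x) ?P + 1 / (D - 1) * contr (XX x) ?P)"
    unfolding Gi_def contr_linear_left ..
  also have "contr (Hi x) ?P = - up_trace h d x / d x + up_square h d x / (d x)\<^sup>2"
    unfolding contr_linear
    by (simp add: up_trace_def up_square_def contr_def comm sum_negf mult_ac)
  \<comment> \<open>This is the second radial derivative of log d. As d has degree
    \<open>?N\<close>, log d grows like \<open>?N\<close> log t along the ray through
    \<open>x\<close>, whose second derivative at t = 1 is \<open>- ?N\<close>.\<close>
  also have "contr (XX x) ?P = - ?N"
  proof -
    have XX: "contr (XX x) E = (\<Sum>j\<in>UNIV. x $ j * (\<Sum>i\<in>UNIV. x $ i * E i j))" for E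
      by (simp add: contr_def XX_def sum_distrib_left mult_ac)
    have E1: "(\<Sum>i\<in>UNIV. x $ i * pd i d x) = ?N * d x"
      unfolding d_def by (rule euler_identity[OF hdet_homogeneous x hdet_diff[OF x]])
    have E2: "(\<Sum>i\<in>UNIV. x $ i * pd i (pd j d) x) = (?N - 1) * pd j d x" for j
      unfolding d_def
      by (rule euler_identity[OF pd_homogeneous_on[OF hdet_homogeneous U_open U_cone hdet_diff] x dhdet_diff[OF x]])
    have P1: "contr (XX x) (\<lambda>i j. pd i (pd j d) x) = (?N - 1) * (?N * d x)"
      unfolding XX E2 E1[symmetric] by (simp add: sum_distrib_left mult_ac)
    have P2: "contr (XX x) (\<lambda>i j. pd i d x * pd j d x) = (?N * d x) * (?N * d x)"
      unfolding XX E1[symmetric] by (simp add: sum_distrib_left sum_distrib_right mult_ac)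
    have "(n - 1) * (n * c) / c - (n * c) * (n * c) / c\<^sup>2 = - n" if "c \<noteq> 0" for n c :: real
      using that by (simp add: field_simps power2_eq_square)
    from this[OF d0] show ?thesis
      unfolding contr_linear P1 P2 .
  qed
  also have "- 1/4 * (4 * (- h x * (- up_trace h d x / d x + up_square h d x / (d x)\<^sup>2) + 1 / (D - 1) * - ?N)
      + 4 * real CARD('n) * real CARD('n))
    = - (real CARD('n))\<^sup>2 + (D - 2) / (D - 1) * real CARD('n)
      - h x / d x * up_trace h d x + h x / (d x)\<^sup>2 * up_square h d x"
    by (simp add: algebra_simps add_divide_distrib diff_divide_distrib power2_eq_square)
  finally show ?thesis .
qed

end

theorem corollary3:
  fixes U :: "(real^'n) set" and h :: "real^'n \<Rightarrow> real" and D :: real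
  assumes "open U" and "connected U" and "U \<noteq> {}"
    and "\<And>x t. x \<in> U \<Longrightarrow> t > 0 \<Longrightarrow> t *\<^sub>R x \<in> U"
    and "smooth_on h U"
    and "\<And>x. x \<in> U \<Longrightarrow> h x > 0"
    and "D > 0" and "D \<noteq> 1"
    and "\<And>x t. x \<in> U \<Longrightarrow> t > 0 \<Longrightarrow> h (t *\<^sub>R x) = t powr D * h x"
    and "riemannian_level_set U h"
  shows "\<forall>z\<in>tube U.
     (\<forall>\<mu> \<nu>. Ric h z $ \<mu> $ \<nu> =
        - pdz \<mu> (pdzbar \<nu> (\<lambda>p. complex_of_real
            (ln (\<bar>hdet h (Im_vec p)\<bar> / h (Im_vec p) ^ CARD('n))))) z) \<and>
     (let x = Im_vec z; d = hdet h; m = real CARD('n) in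
        scal h z = complex_of_real
          (- m\<^sup>2 + (D - 2) / (D - 1) * m
           - h x / d x * up_trace h d x
           + h x / (d x)\<^sup>2 * up_square h d x))"
proof -
  interpret r_map U h D
    using assms by unfold_locales
  show ?thesis
    unfolding Let_def using Ric_formula scal_formula by blast
qed

end
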